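(* Let $A\subset\mathbb{R}^2$ be a finite two-dimensional set, and let $B=A\cup\{b\}$ for some $b\notin A$. Then $$\mathrm{tr}(A+B)^{1/2}\ \ge\ \mathrm{tr}(A)^{1/2}+\mathrm{tr}(B)^{1/2}.$$
   Context: $[X]$ denotes the convex hull of $X$. A finite set $X\subset\mathbb{R}^2$ is two-dimensional if it is not contained in a line. For such $X$, $\mathrm{tr}(X)$ denotes the number of triangles in a triangulation of $[X]$ using exactly $X$ as the vertex set; this number does not depend on the triangulation and equals $2|X|-\Delta_X-2$, where $\Delta_X$ is the number of points of $X$ on the boundary of $[X]$. $A+B=\{a+b:a\in A,b\in B\}$. *)

theory Defs
  imports "HOL-Analysis.Analysis" "HOL-Library.Set_Algebras"
begin

text \<open>\<^const>\<open>triangulation\<close> only asks that the members be simplices meeting face to face.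
  Here the triangulation is given by its triangles (nondegenerate, as \<open>2 simplex t\<close> requires
  affinely independent vertices); the vertices of a triangle are its extreme points.\<close>

definition triangulates :: "(real^2) set set \<Rightarrow> (real^2) set \<Rightarrow> bool" where
  "triangulates T X \<longleftrightarrow>
     triangulation T \<and> (\<forall>t\<in>T. 2 simplex t) \<and>
     \<Union>T = convex hull X \<and>
     {v. \<exists>t\<in>T. v extreme_point_of t} = X"

text \<open>Meaningful for finite non-collinear \<open>X\<close>; the number is the same for all triangulations.\<close>

definition tr :: "(real^2) set \<Rightarrow> nat" where
  "tr X = (THE n. \<exists>T. triangulates T X \<and> card T = n)"

end

theory Submission
  imports Defs
begin

text \<open>Fix a direction \<open>d\<close> not parallel to any difference of points of \<open>X\<close>. In every triangle exactly
  one vertex has the property that one of the rays in directions \<open>d\<close>, \<open>-d\<close> enters the triangle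
  there. So the number of triangles of a triangulation of \<open>X\<close> is the number of pairs \<open>(v, \<plusminus>d)\<close> with
  \<open>v \<in> X\<close> that point into the convex hull, and any family of triangles with vertices in \<open>X\<close> and
  disjoint interiors has at most that many members.

  Halving the sides of \<open>2T\<close> for a triangulation \<open>T\<close> of \<open>A\<close> gives \<open>4 tr(A)\<close> triangles with vertices in
  \<open>A + A\<close>. If \<open>b \<in> [A]\<close>, then at least two points \<open>x + b\<close>, with \<open>x\<close> a vertex of the triangle containing
  \<open>b\<close>, are new, and each contributes as much to \<open>tr(A + B)\<close> as \<open>b\<close> does to \<open>tr(B)\<close>. If \<open>b \<notin> [A]\<close>, extend
  \<open>T\<close> to a triangulation of \<open>B\<close> and halve the sides of its doubled triangles; of these only the corners
  at \<open>2b\<close> are not available in \<open>A + B\<close>. Both ways \<open>tr(A + B) \<ge> 2 tr(A) + 2 tr(B)\<close>.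

  Triangulations are obtained as projections of lower convex hulls of the points \<open>(x, exp (\<tau> (n \<bullet> x)))\<close>
  for generic \<open>n\<close> and large \<open>\<tau>\<close>.\<close>

section \<open>Flags pointing into a triangle\<close>

text \<open>Triangles are handled through their vertex sets, the region being the convex hull;
  common faces then become intersections of finite sets.\<close>

definition tri :: "(real^2) set \<Rightarrow> bool" where
  "tri S \<longleftrightarrow> \<not> affine_dependent S \<and> card S = 3"

lemma tri_finite: "tri S \<Longrightarrow> finite S"
  by (simp add: tri_def aff_independent_finite)

text \<open>The difference \<open>u - v\<close> would be an affine dependence. The common total
  stays arbitrary: it is 1 for points of a triangle and 2 for sums of two such points.\<close>

lemma bary_unique:
  fixes S :: "'a::euclidean_space set"
  assumes "\<not> affine_dependent S" "sum u S = sum v S"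
    "(\<Sum>s\<in>S. u s *\<^sub>R s) = (\<Sum>s\<in>S. v s *\<^sub>R s)" "s \<in> S"
  shows "u s = v s"
proof (rule ccontr)
  assume "u s \<noteq> v s"
  moreover have "finite S" using assms(1) aff_independent_finite by blast
  moreover have "(\<Sum>s\<in>S. u s - v s) = 0" "(\<Sum>s\<in>S. (u s - v s) *\<^sub>R s) = 0"
    using assms(2,3) by (simp_all add: sum_subtractf scaleR_diff_left)
  ultimately have "affine_dependent S"
    unfolding affine_dependent_explicit_finite[OF \<open>finite S\<close>] using \<open>s \<in> S\<close>
    by (intro exI[of _ "\<lambda>s. u s - v s"]) auto
  then show False using assms(1) by blast
qed

lemma tri_affine_hull: "tri S \<Longrightarrow> affine hull S = UNIV"
  using aff_dim_affine_independent[of S] aff_dim_eq_full[of S] by (simp add: tri_def)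

lemma tri_bary:
  assumes "tri S"
  obtains u where "sum u S = 1" "(\<Sum>s\<in>S. u s *\<^sub>R s) = p"
  using tri_affine_hull[OF assms] affine_hull_finite[OF tri_finite[OF assms]] by auto

lemma tri_interior:
  assumes "tri S"
  shows "interior (convex hull S) =
    {p. \<exists>u. (\<forall>s\<in>S. 0 < u s) \<and> sum u S = 1 \<and> (\<Sum>s\<in>S. u s *\<^sub>R s) = p}"
proof -
  have "rel_interior (convex hull S) = interior (convex hull S)"
    by (intro rel_interior_interior) (simp add: affine_hull_convex_hull tri_affine_hull assms)
  then show ?thesis
    using rel_interior_convex_hull_explicit[of S] assms by (simp add: tri_def)
qed

lemma tri_interior_nonempty: "tri S \<Longrightarrow> interior (convex hull S) \<noteq> {}"
  unfolding tri_interior using tri_finite[of S]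
  by (auto simp: tri_def intro!: exI[of _ "\<lambda>_. 1/3"])

section \<open>Generic directions and the flags they define\<close>

definition generic :: "real^2 \<Rightarrow> (real^2) set \<Rightarrow> bool" where
  "generic d X \<longleftrightarrow> d \<noteq> 0 \<and> (\<forall>x\<in>X. \<forall>y\<in>X. \<forall>c. x - y = c *\<^sub>R d \<longrightarrow> x = y)"

lemma generic_mono: "generic d Y \<Longrightarrow> X \<subseteq> Y \<Longrightarrow> generic d X"
  by (auto simp: generic_def)

definition inward :: "(real^2) set \<Rightarrow> real^2 \<Rightarrow> real^2 \<Rightarrow> bool" where
  "inward K v e \<longleftrightarrow> (\<exists>\<epsilon>>0. v + \<epsilon> *\<^sub>R e \<in> K)"

lemma inward_mono: "inward K v e \<Longrightarrow> K \<subseteq> L \<Longrightarrow> inward L v e"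
  by (auto simp: inward_def)

lemma inwardE:
  assumes "convex K" "v \<in> K" "inward K v e"
  obtains \<epsilon> where "\<epsilon> > 0" "\<And>\<delta>. 0 \<le> \<delta> \<Longrightarrow> \<delta> \<le> \<epsilon> \<Longrightarrow> v + \<delta> *\<^sub>R e \<in> K"
proof -
  obtain \<epsilon> where \<epsilon>: "\<epsilon> > 0" "v + \<epsilon> *\<^sub>R e \<in> K" using assms(3) by (auto simp: inward_def)
  have "v + \<delta> *\<^sub>R e \<in> K" if "0 \<le> \<delta>" "\<delta> \<le> \<epsilon>" for \<delta>
  proof -
    have "(1 - \<delta>/\<epsilon>) *\<^sub>R v + (\<delta>/\<epsilon>) *\<^sub>R (v + \<epsilon> *\<^sub>R e) \<in> K"
      using that \<epsilon> assms(1,2) by (intro convexD) auto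
    moreover have "(1 - \<delta>/\<epsilon>) *\<^sub>R v + (\<delta>/\<epsilon>) *\<^sub>R (v + \<epsilon> *\<^sub>R e) = v + \<delta> *\<^sub>R e"
      using \<epsilon> by (simp add: algebra_simps)
    ultimately show ?thesis by simp
  qed
  with \<epsilon> show ?thesis using that by blast
qed

definition flags :: "real^2 \<Rightarrow> (real^2) set \<Rightarrow> (real^2) set \<Rightarrow> ((real^2) \<times> (real^2)) set" where
  "flags d X K = {(v, e). v \<in> X \<and> e \<in> {d, - d} \<and> inward K v e}"

lemma finite_flags: "finite X \<Longrightarrow> finite (flags d X K)"
  by (rule finite_subset[of _ "X \<times> {d, - d}"]) (auto simp: flags_def)

lemma flags_mono: "X \<subseteq> Y \<Longrightarrow> K \<subseteq> L \<Longrightarrow> flags d X K \<subseteq> flags d Y L"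
  by (auto simp: flags_def intro: inward_mono)

lemma sum_delta_scaleR:
  fixes S :: "'a::real_vector set"
  assumes "finite S" "v \<in> S"
  shows "(\<Sum>s\<in>S. (if s = v then a else 0) *\<^sub>R s) = a *\<^sub>R v"
proof -
  have "(\<Sum>s\<in>S. (if s = v then a else 0) *\<^sub>R s) = (\<Sum>s\<in>S. if s = v then a *\<^sub>R s else 0)"
    by (rule sum.cong) auto
  then show ?thesis using assms by simp
qed

text \<open>The \<open>c s\<close> are the barycentric coordinates of the vector \<open>d\<close>:
  those of \<open>v + d\<close> minus those of a vertex \<open>v\<close>. If one of them vanished,
  \<open>d\<close> would be parallel to the side spanned by the other two vertices.\<close>

lemma tri_direction:
  assumes S: "tri S" and d: "generic d S"
  obtains c where "sum c S = 0" "(\<Sum>s\<in>S. c s *\<^sub>R s) = d" "\<And>s. s \<in> S \<Longrightarrow> c s \<noteq> 0"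
proof -
  have fin: "finite S" and ind: "\<not> affine_dependent S" and c3: "card S = 3"
    using S tri_finite by (auto simp: tri_def)
  obtain v where v: "v \<in> S" using c3 by fastforce
  obtain u where u: "sum u S = 1" "(\<Sum>s\<in>S. u s *\<^sub>R s) = v + d" by (rule tri_bary[OF S])
  define c where "c s = u s - (if s = v then 1 else 0)" for s
  have c: "sum c S = 0" "(\<Sum>s\<in>S. c s *\<^sub>R s) = d"
    using u v fin by (simp_all add: c_def sum_subtractf scaleR_diff_left sum_delta_scaleR)
  have "c s \<noteq> 0" if "s \<in> S" for s
  proof
    assume "c s = 0"
    have "card (S - {s}) = 2" using c3 that by simp
    then obtain x y where xy: "S - {s} = {x, y}" "x \<noteq> y" by (meson card_2_iff)
    have "sum c (S - {s}) = 0" "(\<Sum>s\<in>S - {s}. c s *\<^sub>R s) = d"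
      using c \<open>c s = 0\<close> fin that by (simp_all add: sum.remove)
    then have "c x + c y = 0" "c x *\<^sub>R x + c y *\<^sub>R y = d" using xy by simp_all
    then have *: "d = c x *\<^sub>R (x - y)" by (simp add: algebra_simps add_eq_0_iff)
    then have "c x \<noteq> 0" using d by (auto simp: generic_def)
    then have "x - y = (1 / c x) *\<^sub>R d" using * by simp
    moreover have "x \<in> S" "y \<in> S" using xy by auto
    ultimately show False using d xy(2) unfolding generic_def by blast
  qed
  with c show ?thesis using that by blast
qed

lemma bary_move:
  fixes S :: "'a::real_vector set"
  assumes "finite S" "v \<in> S" "sum c S = 0" "(\<Sum>s\<in>S. c s *\<^sub>R s) = d"
  shows "(\<Sum>s\<in>S. (if s = v then 1 else 0) + t * c s) = 1"
    "(\<Sum>s\<in>S. ((if s = v then 1 else 0) + t * c s) *\<^sub>R s) = v + t *\<^sub>R d"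
proof -
  show "(\<Sum>s\<in>S. (if s = v then 1 else 0) + t * c s) = 1"
    using assms by (simp add: sum.distrib flip: sum_distrib_left)
  have "(\<Sum>s\<in>S. ((if s = v then 1 else 0) + t * c s) *\<^sub>R s)
      = (\<Sum>s\<in>S. (if s = v then 1 else 0) *\<^sub>R s) + t *\<^sub>R (\<Sum>s\<in>S. c s *\<^sub>R s)"
    by (simp add: sum.distrib scaleR_add_left scaleR_sum_right)
  then show "(\<Sum>s\<in>S. ((if s = v then 1 else 0) + t * c s) *\<^sub>R s) = v + t *\<^sub>R d"
    using assms by (simp add: sum_delta_scaleR)
qed

text \<open>On the ray from \<open>v\<close> the coordinate at \<open>s\<close> starts at 0 with
  slope \<open>\<sigma> * c s\<close>; a negative slope would leave the triangle at once.\<close>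

lemma tri_inward_nonneg:
  assumes S: "tri S" and c: "sum c S = 0" "(\<Sum>s\<in>S. c s *\<^sub>R s) = d" and v: "v \<in> S"
    and inw: "inward (convex hull S) v (\<sigma> *\<^sub>R d)" and s: "s \<in> S" "s \<noteq> v"
  shows "\<sigma> * c s \<ge> 0"
proof -
  have fin: "finite S" and ind: "\<not> affine_dependent S" using S tri_finite by (auto simp: tri_def)
  obtain \<epsilon> where \<epsilon>: "\<epsilon> > 0" "v + (\<epsilon> * \<sigma>) *\<^sub>R d \<in> convex hull S"
    using inw by (auto simp: inward_def)
  then obtain u where u: "\<And>s. s \<in> S \<Longrightarrow> 0 \<le> u s" "sum u S = 1"
    "(\<Sum>s\<in>S. u s *\<^sub>R s) = v + (\<epsilon> * \<sigma>) *\<^sub>R d"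
    using convex_hull_finite[OF fin] by auto
  have "u s = (if s = v then 1 else 0) + (\<epsilon> * \<sigma>) * c s"
    by (rule bary_unique[OF ind _ _ s(1)]) (simp_all only: bary_move[OF fin v c] u)
  then have "0 \<le> \<epsilon> * (\<sigma> * c s)" using u(1)[OF s(1)] s(2) by (simp add: mult.assoc)
  then show ?thesis using \<epsilon>(1) by (simp add: zero_le_mult_iff)
qed

lemma tri_inward_interior:
  assumes S: "tri S" and c: "sum c S = 0" "(\<Sum>s\<in>S. c s *\<^sub>R s) = d" and v: "v \<in> S"
    and pos: "\<And>s. s \<in> S \<Longrightarrow> s \<noteq> v \<Longrightarrow> \<sigma> * c s > 0"
  obtains \<epsilon> where "\<epsilon> > 0"
    "\<And>\<delta>. 0 < \<delta> \<Longrightarrow> \<delta> \<le> \<epsilon> \<Longrightarrow> v + \<delta> *\<^sub>R (\<sigma> *\<^sub>R d) \<in> interior (convex hull S)"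
proof -
  have fin: "finite S" using S tri_finite by auto
  \<comment> \<open>The coordinate at \<open>v\<close> starts at 1 with slope
    \<open>\<sigma> * c v\<close>; this bound keeps it positive. The others increase from 0.\<close>
  define \<epsilon> where "\<epsilon> = 1 / (1 + \<bar>\<sigma> * c v\<bar>)"
  have "\<epsilon> > 0" by (simp add: \<epsilon>_def)
  moreover have "v + \<delta> *\<^sub>R (\<sigma> *\<^sub>R d) \<in> interior (convex hull S)" if \<delta>: "0 < \<delta>" "\<delta> \<le> \<epsilon>" for \<delta>
  proof -
    have "0 < (if s = v then 1 else 0) + (\<delta> * \<sigma>) * c s" if "s \<in> S" for s
    proof (cases "s = v")
      case True
      have "\<delta> * \<bar>\<sigma> * c v\<bar> \<le> \<epsilon> * \<bar>\<sigma> * c v\<bar>" using \<delta> by (intro mult_right_mono) auto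
      also have "\<dots> < 1" by (simp add: \<epsilon>_def divide_simps)
      finally have "\<bar>\<delta> * (\<sigma> * c v)\<bar> < 1" using \<delta> by (simp add: abs_mult)
      then show ?thesis using True by (simp add: mult.assoc)
    next
      case False
      then show ?thesis using pos[OF that False] \<delta> by (simp add: mult.assoc)
    qed
    then show ?thesis unfolding tri_interior[OF S] mem_Collect_eq
      using bary_move[OF fin v c, of "\<delta> * \<sigma>"]
      by (intro exI[of _ "\<lambda>s. (if s = v then 1 else 0) + (\<delta> * \<sigma>) * c s"]) simp
  qed
  ultimately show ?thesis using that by blast
qed

text \<open>Of three nonzero coordinates with sum 0, one has a sign different from the other two.
  The flag sits at that vertex, with the direction that makes the other two coordinates grow. The
  interior segment later separates the flags of triangles with disjoint interiors.\<close>

lemma tri_flag: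
  assumes S: "tri S" and d: "generic d S"
  obtains v e \<epsilon> where "flags d S (convex hull S) = {(v, e)}" "\<epsilon> > 0"
    "\<And>\<delta>. 0 < \<delta> \<Longrightarrow> \<delta> \<le> \<epsilon> \<Longrightarrow> v + \<delta> *\<^sub>R e \<in> interior (convex hull S)"
proof -
  obtain c where c: "sum c S = 0" "(\<Sum>s\<in>S. c s *\<^sub>R s) = d" "\<And>s. s \<in> S \<Longrightarrow> c s \<noteq> 0"
    by (rule tri_direction[OF S d]) blast
  obtain x y z where xyz: "S = {x,y,z}" "x \<noteq> y" "x \<noteq> z" "y \<noteq> z"
    using S by (auto simp: tri_def card_3_iff)
  have "c x + c y + c z = 0" "c x \<noteq> 0" "c y \<noteq> 0" "c z \<noteq> 0"
    using c xyz by (auto simp: add.assoc)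
  then have "\<exists>\<sigma>\<in>{1,-1}. \<exists>v\<in>S. \<sigma> * c v < 0 \<and> (\<forall>s\<in>S. s \<noteq> v \<longrightarrow> \<sigma> * c s > 0)"
    unfolding xyz(1) using xyz(2-) by simp linarith
  then obtain \<sigma> v where \<sigma>: "\<sigma> = 1 \<or> \<sigma> = -1" and v: "v \<in> S" "\<sigma> * c v < 0"
    and s: "\<And>s. s \<in> S \<Longrightarrow> s \<noteq> v \<Longrightarrow> \<sigma> * c s > 0" by blast
  obtain \<epsilon> where \<epsilon>: "\<epsilon> > 0"
    "\<And>\<delta>. 0 < \<delta> \<Longrightarrow> \<delta> \<le> \<epsilon> \<Longrightarrow> v + \<delta> *\<^sub>R (\<sigma> *\<^sub>R d) \<in> interior (convex hull S)"
    using tri_inward_interior[OF S c(1,2) v(1) s] by blast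
  have in1: "(v, \<sigma> *\<^sub>R d) \<in> flags d S (convex hull S)"
    using \<epsilon> v(1) \<sigma> interior_subset[of "convex hull S"] by (auto simp: flags_def inward_def)
  have uniq: "w = v \<and> \<tau> = \<sigma>"
    if w: "w \<in> S" and \<tau>: "\<tau> = 1 \<or> \<tau> = -1" and i: "inward (convex hull S) w (\<tau> *\<^sub>R d)" for w \<tau>
  proof -
    note nn = tri_inward_nonneg[OF S c(1,2) w i]
    have "\<tau> = \<sigma>"
    proof (rule ccontr)
      assume "\<tau> \<noteq> \<sigma>"
      then have ts: "\<tau> = -\<sigma>" using \<tau> \<sigma> by auto
      have "\<exists>s\<in>S. s \<noteq> v \<and> s \<noteq> w" unfolding xyz(1) using xyz(2-) by auto
      then obtain r where "r \<in> S" "r \<noteq> v" "r \<noteq> w" by auto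
      then show False using nn[of r] s[of r] ts by simp
    qed
    moreover have "w = v" using nn[of v] v \<open>\<tau> = \<sigma>\<close> by force
    ultimately show ?thesis by simp
  qed
  have "flags d S (convex hull S) = {(v, \<sigma> *\<^sub>R d)}"
  proof (intro subset_antisym subsetI)
    fix p assume "p \<in> flags d S (convex hull S)"
    then obtain w e where p: "p = (w, e)" "w \<in> S" "e = d \<or> e = -d" "inward (convex hull S) w e"
      by (auto simp: flags_def)
    then obtain \<tau> where "\<tau> = 1 \<or> \<tau> = -1" "e = \<tau> *\<^sub>R d" by (metis scaleR_minus1_left scaleR_one)
    then show "p \<in> {(v, \<sigma> *\<^sub>R d)}" using uniq p by auto
  qed (use in1 in auto)
  then show ?thesis using that \<epsilon> by blast
qed

section \<open>Counting the triangles of a triangulation\<close>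

text \<open>Serves for lower bounds: such triangles need not fill a hull or meet face to
  face.\<close>

definition packing :: "(real^2) set set \<Rightarrow> bool" where
  "packing F \<longleftrightarrow> finite F \<and> (\<forall>S\<in>F. tri S) \<and>
     (\<forall>S\<in>F. \<forall>S'\<in>F. S \<noteq> S' \<longrightarrow> interior (convex hull S) \<inter> interior (convex hull S') = {})"

text \<open>The form of \<open>triangulates\<close> in terms of vertex sets. Meeting in a common
  face becomes meeting in the hull of the common vertices.\<close>

definition mesh :: "(real^2) set set \<Rightarrow> (real^2) set \<Rightarrow> bool" where
  "mesh F X \<longleftrightarrow> finite F \<and> (\<forall>S\<in>F. tri S) \<and>
     (\<forall>S\<in>F. \<forall>S'\<in>F. convex hull S \<inter> convex hull S' = convex hull (S \<inter> S')) \<and>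
     (\<Union>S\<in>F. convex hull S) = convex hull X \<and> \<Union>F = X"

lemma meshD:
  assumes "mesh F X"
  shows "finite F" "S \<in> F \<Longrightarrow> tri S"
    "S \<in> F \<Longrightarrow> S' \<in> F \<Longrightarrow> convex hull S \<inter> convex hull S' = convex hull (S \<inter> S')"
    "(\<Union>S\<in>F. convex hull S) = convex hull X" "\<Union>F = X"
  using assms unfolding mesh_def by blast+

text \<open>Two different triples share at most two points, and the hull of two points in the plane
  has empty interior.\<close>

lemma mesh_packing: "mesh F X \<Longrightarrow> packing F"
  unfolding packing_def
proof (intro conjI ballI impI)
  assume m: "mesh F X"
  then show "finite F" "\<And>S. S \<in> F \<Longrightarrow> tri S" by (auto simp: mesh_def)
  fix S S' assume S: "S \<in> F" "S' \<in> F" "S \<noteq> S'"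
  have fin: "finite S" "finite S'" "card S = 3" "card S' = 3"
    using m S tri_finite by (auto simp: mesh_def tri_def)
  have "S \<inter> S' \<noteq> S"
    using fin S(3) by (metis card_subset_eq inf.cobounded2)
  then have "card (S \<inter> S') < 3"
    using fin by (metis inf.cobounded1 psubsetI psubset_card_mono)
  then have "interior (convex hull (S \<inter> S')) = {}"
    using fin by (intro empty_interior_convex_hull) auto
  then show "interior (convex hull S) \<inter> interior (convex hull S') = {}"
    using m S by (metis interior_Int mesh_def)
qed

text \<open>Each triangle contributes a single flag by \<open>tri_flag\<close>. A flag shared by two
  triangles would place a short piece of the same ray in both interiors.\<close>

lemma card_packing_flags:
  assumes F: "packing F" and d: "generic d (\<Union>F)"
  shows "card (\<Union>S\<in>F. flags d S (convex hull S)) = card F"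
proof -
  have tri: "tri S" "generic d S" if "S \<in> F" for S
    using F d that by (auto simp: packing_def intro: generic_mono)
  have "card (flags d S (convex hull S)) = 1" if "S \<in> F" for S
    by (rule tri_flag[OF tri[OF that]]) simp
  moreover have "flags d S (convex hull S) \<inter> flags d S' (convex hull S') = {}"
    if SS: "S \<in> F" "S' \<in> F" "S \<noteq> S'" for S S'
  proof (rule ccontr)
    assume ne: "flags d S (convex hull S) \<inter> flags d S' (convex hull S') \<noteq> {}"
    obtain v e \<epsilon> where 1: "flags d S (convex hull S) = {(v, e)}" "\<epsilon> > 0"
      "\<And>\<delta>. 0 < \<delta> \<Longrightarrow> \<delta> \<le> \<epsilon> \<Longrightarrow> v + \<delta> *\<^sub>R e \<in> interior (convex hull S)"
      by (rule tri_flag[OF tri[OF SS(1)]]) blast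
    obtain v' e' \<epsilon>' where 2: "flags d S' (convex hull S') = {(v', e')}" "\<epsilon>' > 0"
      "\<And>\<delta>. 0 < \<delta> \<Longrightarrow> \<delta> \<le> \<epsilon>' \<Longrightarrow> v' + \<delta> *\<^sub>R e' \<in> interior (convex hull S')"
      by (rule tri_flag[OF tri[OF SS(2)]]) blast
    have "v' = v" "e' = e" using ne 1(1) 2(1) by auto
    then have "v + min \<epsilon> \<epsilon>' *\<^sub>R e \<in> interior (convex hull S) \<inter> interior (convex hull S')"
      using 1(2,3) 2(2,3) by auto
    then show False using F SS by (auto simp: packing_def)
  qed
  moreover have "finite (flags d S (convex hull S))" if "S \<in> F" for S
    using tri[OF that] by (intro finite_flags tri_finite) auto
  moreover have "finite F" using F by (simp add: packing_def)
  ultimately show ?thesis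
    by (subst card_UN_disjoint) auto
qed

lemma packing_card_le:
  assumes F: "packing F" and d: "generic d Y" and Y: "finite Y" "\<Union>F \<subseteq> Y"
    and K: "\<And>S. S \<in> F \<Longrightarrow> convex hull S \<subseteq> K"
  shows "card F \<le> card (flags d Y K)"
proof -
  have "card F = card (\<Union>S\<in>F. flags d S (convex hull S))"
    using card_packing_flags[OF F] generic_mono[OF d Y(2)] by simp
  also have "\<dots> \<le> card (flags d Y K)"
  proof (rule card_mono[OF finite_flags[OF Y(1)]])
    show "(\<Union>S\<in>F. flags d S (convex hull S)) \<subseteq> flags d Y K"
      using Y(2) K by (intro UN_least flags_mono) auto
  qed
  finally show ?thesis .
qed

text \<open>Points of the ray that converge to \<open>v\<close> are distributed over finitely many
  closed sets. One set receives infinitely many of them, so it also contains the limit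
  \<open>v\<close>.\<close>

lemma inward_finite_union:
  assumes fin: "finite F" and conv: "\<And>C. C \<in> F \<Longrightarrow> convex C" and cl: "\<And>C. C \<in> F \<Longrightarrow> closed C"
    and K: "convex K" "v \<in> K" "K \<subseteq> \<Union>F" and i: "inward K v e"
  shows "\<exists>C\<in>F. v \<in> C \<and> inward C v e"
proof -
  obtain \<epsilon> where \<epsilon>: "\<epsilon> > 0" "\<And>\<delta>. 0 \<le> \<delta> \<Longrightarrow> \<delta> \<le> \<epsilon> \<Longrightarrow> v + \<delta> *\<^sub>R e \<in> K"
    by (rule inwardE[OF K(1,2) i]) blast
  define p where "p n = v + (\<epsilon> / real (Suc n)) *\<^sub>R e" for n
  have "p n \<in> K" for n unfolding p_def using \<epsilon>(1) by (intro \<epsilon>(2)) (auto simp: divide_simps)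
  then have "\<forall>n. \<exists>C\<in>F. p n \<in> C" using K(3) by blast
  then obtain g where g: "\<And>n. g n \<in> F" "\<And>n. p n \<in> g n" by metis
  have "finite (range g)" using g(1) fin by (meson finite_subset image_subsetI)
  then obtain k where k: "infinite {n. g n = g k}"
    using inf_img_fin_dom[of g UNIV] by (auto simp: vimage_def)
  let ?C = "g k"
  have "v \<in> ?C"
  proof (rule closed_sequentially)
    show "closed ?C" using cl g by blast
    let ?r = "enumerate {n. g n = g k}"
    show "(p \<circ> ?r) n \<in> ?C" for n
      using enumerate_in_set[OF k, of n] g(2)[of "?r n"] by auto
    have "(\<lambda>n. \<epsilon> / real (Suc n)) \<longlonglongrightarrow> 0"
      by (rule LIMSEQ_Suc[OF lim_const_over_n])
    then have "p \<longlonglongrightarrow> v + 0 *\<^sub>R e" unfolding p_def by (intro tendsto_intros)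
    then show "(p \<circ> ?r) \<longlonglongrightarrow> v"
      using LIMSEQ_subseq_LIMSEQ[OF _ strict_mono_enumerate[OF k]] by simp
  qed
  moreover have "inward ?C v e" unfolding inward_def
    using g(2)[of k] \<epsilon>(1) by (intro exI[of _ "\<epsilon> / real (Suc k)"]) (auto simp: p_def)
  ultimately show ?thesis using g(1) by blast
qed

lemma vertex_in_convex_hull_subset:
  fixes S :: "'a::euclidean_space set"
  assumes "\<not> affine_dependent S" "v \<in> S" "C \<subseteq> S" "v \<in> convex hull C"
  shows "v \<in> C"
proof (rule ccontr)
  assume "v \<notin> C"
  then have "C \<subseteq> S - {v}" using assms(3) by blast
  then have "convex hull C \<subseteq> affine hull (S - {v})"
    by (meson convex_hull_subset_affine_hull hull_mono order_trans)
  then show False using assms(1,2,4) unfolding affine_dependent_def by blast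
qed

text \<open>As a vertex of some \<open>S'\<close>, the point \<open>v\<close> lies in the hull of
  \<open>S \<inter> S'\<close> by the intersection condition. Affine independence of
  \<open>S'\<close> then makes it a common vertex.\<close>

lemma mesh_vertex:
  assumes m: "mesh F X" and S: "S \<in> F" and v: "v \<in> X" "v \<in> convex hull S"
  shows "v \<in> S"
proof -
  obtain S' where S': "S' \<in> F" "v \<in> S'" using v(1) meshD(5)[OF m] by blast
  have "v \<in> convex hull (S \<inter> S')"
    using meshD(3)[OF m S S'(1)] v(2) hull_inc[OF S'(2), of convex] by blast
  then have "v \<in> S \<inter> S'"
    using meshD(2)[OF m S'(1)] S'(2) vertex_in_convex_hull_subset[of S' v "S \<inter> S'"]
    by (simp add: tri_def)
  then show ?thesis by simp
qed

text \<open>A ray entering the hull at \<open>v\<close> enters one of the finitely many triangles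
  containing \<open>v\<close>, and \<open>v\<close> is a vertex of that triangle. So the flags of
  the hull are those of the triangles, and their number does not refer to the mesh.\<close>

lemma mesh_card:
  assumes m: "mesh F X" and d: "generic d X"
  shows "card F = card (flags d X (convex hull X))"
proof -
  have fin: "finite F" and t: "\<And>S. S \<in> F \<Longrightarrow> tri S"
    and cov: "(\<Union>S\<in>F. convex hull S) = convex hull X" and X: "\<Union>F = X"
    using meshD[OF m] by blast+
  have "flags d X (convex hull X) = (\<Union>S\<in>F. flags d S (convex hull S))"
  proof (intro subset_antisym subsetI)
    fix p assume "p \<in> flags d X (convex hull X)"
    then obtain v e where p: "p = (v, e)" "v \<in> X" "e \<in> {d, -d}" "inward (convex hull X) v e"
      by (auto simp: flags_def)
    have "\<exists>C\<in>(hull) convex ` F. v \<in> C \<and> inward C v e"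
    proof (rule inward_finite_union)
      show "convex hull X \<subseteq> \<Union> ((hull) convex ` F)" using cov by simp
      show "closed C" if "C \<in> (hull) convex ` F" for C
        using that t tri_finite by (auto intro: compact_imp_closed finite_imp_compact_convex_hull)
    qed (use fin p in \<open>auto intro: hull_inc\<close>)
    then obtain S where S: "S \<in> F" "v \<in> convex hull S" "inward (convex hull S) v e" by auto
    then have "v \<in> S" using mesh_vertex[OF m] p by blast
    then show "p \<in> (\<Union>S\<in>F. flags d S (convex hull S))"
      using S p by (auto simp: flags_def)
  next
    fix p assume "p \<in> (\<Union>S\<in>F. flags d S (convex hull S))"
    then obtain S where "S \<in> F" "p \<in> flags d S (convex hull S)" by blast
    moreover have "flags d S (convex hull S) \<subseteq> flags d X (convex hull X)"
      using \<open>S \<in> F\<close> X by (intro flags_mono hull_mono) auto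
    ultimately show "p \<in> flags d X (convex hull X)" by blast
  qed
  then show ?thesis
    using card_packing_flags[OF mesh_packing[OF m]] d X by simp
qed

section \<open>From meshes to triangulations and back\<close>

lemma tri_simplex: "tri S \<Longrightarrow> 2 simplex (convex hull S)"
  by (auto simp: simplex_def tri_def)

lemma tri_extreme: "tri S \<Longrightarrow> {v. v extreme_point_of (convex hull S)} = S"
  by (auto simp: tri_def extreme_point_of_convex_hull_affine_independent)

lemma inj_on_tri_hull: "(\<And>S. S \<in> F \<Longrightarrow> tri S) \<Longrightarrow> inj_on ((hull) convex) F"
  by (metis inj_onI tri_extreme)

lemma mesh_triangulates:
  assumes m: "mesh F X"
  shows "triangulates ((hull) convex ` F) X" "card ((hull) convex ` F) = card F"
proof -
  have t: "\<And>S. S \<in> F \<Longrightarrow> tri S" using meshD[OF m] by blast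
  show "card ((hull) convex ` F) = card F" using t by (intro card_image inj_on_tri_hull)
  have "triangulation ((hull) convex ` F)" unfolding triangulation_def
  proof (intro conjI ballI allI impI)
    show "finite ((hull) convex ` F)" using m by (simp add: mesh_def)
    fix T assume "T \<in> (hull) convex ` F"
    then show "\<exists>n. n simplex T" using t tri_simplex by blast
  next
    fix T T' assume "T \<in> (hull) convex ` F \<and> T' \<in> (hull) convex ` F"
    then obtain S S' where S: "S \<in> F" "S' \<in> F" "T = convex hull S" "T' = convex hull S'" by blast
    then have "T \<inter> T' = convex hull (S \<inter> S')" using meshD(3)[OF m] by simp
    then show "(T \<inter> T') face_of T"
      using face_of_convex_hull_affine_independent[of S] t S by (auto simp: tri_def)
  qed
  moreover have "{v. \<exists>t\<in>(hull) convex ` F. v extreme_point_of t} = \<Union>F"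
    using tri_extreme t by blast
  moreover have "\<forall>t\<in>(hull) convex ` F. 2 simplex t" using t tri_simplex by blast
  ultimately show "triangulates ((hull) convex ` F) X"
    using meshD(4,5)[OF m] by (simp add: triangulates_def)
qed

text \<open>The intersection of two triangles is a face of both. As a face of the first it is the
  hull of some of its vertices; these are extreme in the intersection, hence in the second triangle
  too.\<close>

lemma triangulates_mesh:
  assumes T: "triangulates T X"
  obtains F where "mesh F X" "card F = card T"
proof -
  have "\<exists>S. tri S \<and> t = convex hull S" if "t \<in> T" for t
    using T that by (auto simp: triangulates_def simplex_def tri_def)
  then obtain V where V: "\<And>t. t \<in> T \<Longrightarrow> tri (V t)" "\<And>t. t \<in> T \<Longrightarrow> convex hull (V t) = t" by metis
  have "inj_on V T" by (metis V(2) inj_onI)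
  then have c: "card (V ` T) = card T" by (rule card_image)
  have ext: "v extreme_point_of t \<longleftrightarrow> v \<in> V t" if "t \<in> T" for v t
    using tri_extreme[OF V(1)[OF that]] V(2)[OF that] by auto
  have int: "t \<inter> t' = convex hull (V t \<inter> V t')" if "t \<in> T" "t' \<in> T" for t t'
  proof
    have f: "(t \<inter> t') face_of t" "(t \<inter> t') face_of t'"
      using T that unfolding triangulates_def triangulation_def by (metis inf_commute)+
    have Vt: "tri (V t)" "convex hull (V t) = t" using V that(1) by auto
    then obtain C where C: "C \<subseteq> V t" "t \<inter> t' = convex hull C"
      using face_of_convex_hull_affine_independent[of "V t" "t \<inter> t'"] f(1)
      by (auto simp: tri_def)
    have "\<not> affine_dependent C" using C(1) V(1)[OF that(1)] affine_dependent_subset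
      by (auto simp: tri_def)
    then have "v extreme_point_of (t \<inter> t')" if "v \<in> C" for v
      using extreme_point_of_convex_hull_affine_independent C that by metis
    then have "C \<subseteq> V t'"
      using extreme_point_of_face[OF f(2)] ext[OF that(2)] by blast
    then show "t \<inter> t' \<subseteq> convex hull (V t \<inter> V t')"
      unfolding C(2) using C(1) by (intro hull_mono) auto
    show "convex hull (V t \<inter> V t') \<subseteq> t \<inter> t'"
      using V(2) that by (metis hull_mono inf.bounded_iff inf_le1 inf_le2)
  qed
  have "mesh (V ` T) X" unfolding mesh_def
  proof (intro conjI)
    show "finite (V ` T)" using T by (auto simp: triangulates_def triangulation_def)
    show "\<forall>S\<in>V ` T. tri S" using V by blast
    show "\<forall>S\<in>V ` T. \<forall>S'\<in>V ` T. convex hull S \<inter> convex hull S' = convex hull (S \<inter> S')"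
      using V(2) int by auto
    show "(\<Union>S\<in>V ` T. convex hull S) = convex hull X"
      using V(2) T by (auto simp: triangulates_def)
    show "\<Union> (V ` T) = X" using ext T by (auto simp: triangulates_def)
  qed
  then show ?thesis using that c by blast
qed

text \<open>Each pair of distinct points excludes a hyperplane of vectors \<open>n\<close>, and
  finitely many hyperplanes cannot cover a nonempty open set. The freedom in \<open>U\<close> later
  allows \<open>n\<close> to separate \<open>b\<close> from \<open>A\<close> as well.\<close>

lemma injective_functional:
  fixes X U :: "('a::euclidean_space) set"
  assumes "finite X" "open U" "U \<noteq> {}"
  obtains n where "n \<in> U" "inj_on ((\<bullet>) n) X"
proof -
  let ?N = "\<Union>(x, y)\<in>{(x, y). x \<in> X \<and> y \<in> X \<and> x \<noteq> y}. {n. (x - y) \<bullet> n = 0}"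
  have "{(x, y). x \<in> X \<and> y \<in> X \<and> x \<noteq> y} \<subseteq> X \<times> X" by auto
  then have "finite {(x, y). x \<in> X \<and> y \<in> X \<and> x \<noteq> y}"
    using assms(1) finite_subset by blast
  then have "negligible ?N"
    by (intro negligible_Union finite_imageI) (auto intro!: negligible_hyperplane)
  then have "\<not> U \<subseteq> ?N"
    using open_not_negligible[OF assms(2,3)] negligible_subset by blast
  then obtain n where "n \<in> U" "n \<notin> ?N" by blast
  then show ?thesis
    by (intro that[of n]) (auto simp: inj_on_def inner_commute inner_diff_right algebra_simps)
qed

lemma generic_exists:
  assumes "finite X"
  obtains d where "generic d X"
proof -
  obtain n :: "real^2" where n: "inj_on ((\<bullet>) n) X"
    using injective_functional[OF assms, of UNIV] by auto
  obtain d where d: "d \<noteq> 0" "orthogonal n d"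
    by (rule orthogonal_to_vector_exists[of n]) auto
  have "generic d X" unfolding generic_def
  proof (intro conjI ballI allI impI d)
    fix x y c assume *: "x \<in> X" "y \<in> X" "x - y = c *\<^sub>R d"
    have "n \<bullet> (x - y) = 0" using d unfolding *(3) by (simp add: orthogonal_def)
    then show "x = y" using n *(1,2) by (auto simp: inner_diff_right inj_on_def)
  qed
  then show ?thesis using that by blast
qed

section \<open>Well-definedness of the number of triangles\<close>

lemma mesh_card_unique:
  assumes "mesh F X" "mesh G X" "finite X"
  shows "card F = card G"
  by (rule generic_exists[OF assms(3)]) (simp add: mesh_card[OF assms(1)] mesh_card[OF assms(2)])

lemma tr_mesh:
  assumes F: "mesh F X" and X: "finite X"
  shows "tr X = card F"
  unfolding tr_def
proof (rule the_equality)
  show "\<exists>T. triangulates T X \<and> card T = card F" using mesh_triangulates[OF F] by blast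
  fix n assume "\<exists>T. triangulates T X \<and> card T = n"
  then obtain T where T: "triangulates T X" "card T = n" by blast
  obtain G where "mesh G X" "card G = card T" by (rule triangulates_mesh[OF T(1)])
  then show "n = card F" using mesh_card_unique[OF F _ X] T(2) by simp
qed

section \<open>Triangulations from lower convex hulls\<close>

definition affine_map :: "(real^2 \<Rightarrow> real) \<Rightarrow> bool" where
  "affine_map f \<longleftrightarrow> (\<exists>g c. linear g \<and> f = (\<lambda>x. g x + c))"

lemma affine_map_sum:
  assumes f: "affine_map f" and u: "sum u S = 1"
  shows "f (\<Sum>s\<in>S. u s *\<^sub>R s) = (\<Sum>s\<in>S. u s * f s)"
proof -
  obtain g c where g: "linear g" "f = (\<lambda>x. g x + c)" using f by (auto simp: affine_map_def)
  have "f (\<Sum>s\<in>S. u s *\<^sub>R s) = (\<Sum>s\<in>S. u s * g s) + c"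
    using g by (simp add: linear_sum linear_scale)
  also have "\<dots> = (\<Sum>s\<in>S. u s * f s)"
    using u by (simp add: g(2) distrib_left sum.distrib flip: sum_distrib_right)
  finally show ?thesis .
qed

lemma affine_interpolation:
  assumes "tri S"
  obtains f where "affine_map f" "\<And>s. s \<in> S \<Longrightarrow> f s = h s"
proof -
  obtain a where a: "a \<in> S" using assms by (fastforce simp: tri_def)
  have "independent ((\<lambda>x. - a + x) ` (S - {a}))"
    using affine_dependent_iff_dependent2[OF a] assms by (simp add: tri_def)
  then obtain g where g: "linear g"
    "\<forall>x\<in>(\<lambda>x. - a + x) ` (S - {a}). g x = h (a + x) - h a"
    using linear_independent_extend[of "(\<lambda>x. - a + x) ` (S - {a})" "\<lambda>x. h (a + x) - h a"] by blast
  define f where "f x = g x + (h a - g a)" for x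
  have "affine_map f" unfolding affine_map_def
    by (intro exI[of _ g] exI[of _ "h a - g a"]) (simp add: g(1) f_def fun_eq_iff)
  moreover have "f s = h s" if "s \<in> S" for s
  proof (cases "s = a")
    case False
    then have "- a + s \<in> (\<lambda>x. - a + x) ` (S - {a})" using that by blast
    then have "g (- a + s) = h (a + (- a + s)) - h a" using g(2) by blast
    then show ?thesis using linear_diff[OF g(1), of s a] by (simp add: f_def)
  qed (simp add: f_def)
  ultimately show ?thesis using that by blast
qed

text \<open>These are the projected triangular facets of the lower convex hull of the points
  \<open>(x, h x)\<close>; the graph of \<open>f\<close> is the supporting plane. Strictness outside
  \<open>S\<close> makes it touch no other lifted point.\<close>

definition lower_tris :: "(real^2 \<Rightarrow> real) \<Rightarrow> (real^2) set \<Rightarrow> (real^2) set set" where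
  "lower_tris h X = {S. S \<subseteq> X \<and> tri S \<and>
     (\<exists>f. affine_map f \<and> (\<forall>s\<in>S. f s = h s) \<and> (\<forall>x\<in>X - S. f x < h x))}"

lemma lower_trisE:
  assumes "S \<in> lower_tris h X"
  obtains f where "S \<subseteq> X" "tri S" "affine_map f" "\<And>s. s \<in> S \<Longrightarrow> f s = h s"
    "\<And>x. x \<in> X \<Longrightarrow> x \<notin> S \<Longrightarrow> f x < h x"
  using assms unfolding lower_tris_def by blast

lemma convex_hull_finiteE:
  fixes S :: "'a::real_vector set"
  assumes "p \<in> convex hull S" "finite S"
  obtains u where "\<And>s. s \<in> S \<Longrightarrow> 0 \<le> u s" "sum u S = 1" "(\<Sum>s\<in>S. u s *\<^sub>R s) = p"
  using assms convex_hull_finite[OF assms(2)] by auto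

text \<open>The function \<open>f\<close> agrees with \<open>h\<close> on \<open>S\<close>, is
  nowhere above it on \<open>X\<close>, and being affine gives the same value for both
  representations of the point. Equality leaves no weight where \<open>f\<close> is strictly below
  \<open>h\<close>.\<close>

lemma lower_tris_le:
  assumes S: "S \<in> lower_tris h X" and Y: "finite Y" "Y \<subseteq> X"
    and u: "\<And>s. s \<in> S \<Longrightarrow> 0 \<le> u s" "sum u S = 1"
    and v: "\<And>s. s \<in> Y \<Longrightarrow> 0 \<le> v s" "sum v Y = 1"
    and eq: "(\<Sum>s\<in>S. u s *\<^sub>R s) = (\<Sum>s\<in>Y. v s *\<^sub>R s)"
  shows "(\<Sum>s\<in>S. u s * h s) \<le> (\<Sum>s\<in>Y. v s * h s)"
    and "(\<Sum>s\<in>Y. v s * h s) \<le> (\<Sum>s\<in>S. u s * h s) \<Longrightarrow> s \<in> Y \<Longrightarrow> v s \<noteq> 0 \<Longrightarrow> s \<in> S"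
proof -
  obtain f where f: "S \<subseteq> X" "affine_map f" "\<And>s. s \<in> S \<Longrightarrow> f s = h s"
    "\<And>x. x \<in> X \<Longrightarrow> x \<notin> S \<Longrightarrow> f x < h x" using S by (auto elim: lower_trisE)
  have le: "f x \<le> h x" if "x \<in> X" for x using f(3,4) that by (cases "x \<in> S") (auto simp: less_imp_le)
  have eq: "(\<Sum>s\<in>S. u s * h s) = (\<Sum>s\<in>Y. v s * f s)"
    using affine_map_sum[OF f(2) u(2)] affine_map_sum[OF f(2) v(2)] eq f(3) by simp
  have vle: "v s * f s \<le> v s * h s" if "s \<in> Y" for s
    using that Y(2) le v(1) by (intro mult_left_mono) auto
  show "(\<Sum>s\<in>S. u s * h s) \<le> (\<Sum>s\<in>Y. v s * h s)"
    unfolding eq using vle by (intro sum_mono) auto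
  assume *: "(\<Sum>s\<in>Y. v s * h s) \<le> (\<Sum>s\<in>S. u s * h s)" "s \<in> Y" "v s \<noteq> 0"
  show "s \<in> S"
  proof (rule ccontr)
    assume "s \<notin> S"
    then have "v s * f s < v s * h s"
      using f(4)[of s] * Y(2) v(1)[of s] by (intro mult_strict_left_mono) auto
    then have "(\<Sum>s\<in>Y. v s * f s) < (\<Sum>s\<in>Y. v s * h s)"
      using vle \<open>s \<in> Y\<close> Y(1) by (intro sum_strict_mono_ex1) auto
    then show False using *(1) eq by simp
  qed
qed

text \<open>A common point has a representation over each triangle. Minimality of both lifts gives
  equal heights, so by the equality case the weights sit on common vertices.\<close>

lemma lower_tris_Int:
  assumes S: "S \<in> lower_tris h X" and S': "S' \<in> lower_tris h X"
  shows "convex hull S \<inter> convex hull S' = convex hull (S \<inter> S')"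
proof
  have fin: "finite S" "finite S'" "S \<subseteq> X" "S' \<subseteq> X"
    using S S' tri_finite by (auto simp: lower_tris_def)
  show "convex hull S \<inter> convex hull S' \<subseteq> convex hull (S \<inter> S')"
  proof
    fix p assume "p \<in> convex hull S \<inter> convex hull S'"
    then have p: "p \<in> convex hull S" "p \<in> convex hull S'" by auto
    obtain u where u: "\<And>s. s \<in> S \<Longrightarrow> 0 \<le> u s" "sum u S = 1" "(\<Sum>s\<in>S. u s *\<^sub>R s) = p"
      by (rule convex_hull_finiteE[OF p(1) fin(1)]) blast
    obtain v where v: "\<And>s. s \<in> S' \<Longrightarrow> 0 \<le> v s" "sum v S' = 1" "(\<Sum>s\<in>S'. v s *\<^sub>R s) = p"
      by (rule convex_hull_finiteE[OF p(2) fin(2)]) blast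
    have le: "(\<Sum>s\<in>S. u s * h s) \<le> (\<Sum>s\<in>S'. v s * h s)"
      using lower_tris_le(1)[OF S fin(2,4) u(1,2) v(1,2)] u(3) v(3) by simp
    have z: "s \<in> S'" if "s \<in> S" "u s \<noteq> 0" for s
      using lower_tris_le(2)[OF S' fin(1,3) v(1,2) u(1,2)] u(3) v(3) le that by metis
    have "sum u (S \<inter> S') = sum u S" "(\<Sum>s\<in>S \<inter> S'. u s *\<^sub>R s) = (\<Sum>s\<in>S. u s *\<^sub>R s)"
      using z fin(1) by (auto intro!: sum.mono_neutral_left)
    then show "p \<in> convex hull (S \<inter> S')"
      using u fin(1) by (auto simp: convex_hull_finite intro!: exI[of _ u])
  qed
  show "convex hull (S \<inter> S') \<subseteq> convex hull S \<inter> convex hull S'"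
    by (simp add: hull_mono)
qed

text \<open>Read on the lifted points \<open>(x, h x)\<close>: they are in convex position, and no four of them
  whose projections contain a nondegenerate triangle are coplanar.\<close>

definition convex_position :: "(real^2 \<Rightarrow> real) \<Rightarrow> (real^2) set \<Rightarrow> bool" where
  "convex_position h X \<longleftrightarrow> (\<forall>S u x. S \<subseteq> X \<and> finite S \<and> x \<in> X - S \<and> (\<forall>s\<in>S. 0 \<le> u s) \<and>
     sum u S = 1 \<and> (\<Sum>s\<in>S. u s *\<^sub>R s) = x \<longrightarrow> h x < (\<Sum>s\<in>S. u s * h s))"

definition no_coplanar :: "(real^2 \<Rightarrow> real) \<Rightarrow> (real^2) set \<Rightarrow> bool" where
  "no_coplanar h X \<longleftrightarrow> (\<forall>S u x. S \<subseteq> X \<and> tri S \<and> x \<in> X - S \<and>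
     sum u S = 1 \<and> (\<Sum>s\<in>S. u s *\<^sub>R s) = x \<longrightarrow> h x \<noteq> (\<Sum>s\<in>S. u s * h s))"

text \<open>Otherwise convex position places the lift of \<open>x\<close> strictly below the facet
  over \<open>S\<close>, while minimality of that facet, compared with \<open>x\<close> alone,
  places it on or above.\<close>

lemma lower_tris_vertex:
  assumes cp: "convex_position h X" and S: "S \<in> lower_tris h X"
    and x: "x \<in> X" "x \<in> convex hull S"
  shows "x \<in> S"
proof (rule ccontr)
  assume nx: "x \<notin> S"
  have fin: "finite S" "S \<subseteq> X" using S tri_finite by (auto simp: lower_tris_def)
  obtain u where u: "\<And>s. s \<in> S \<Longrightarrow> 0 \<le> u s" "sum u S = 1" "(\<Sum>s\<in>S. u s *\<^sub>R s) = x"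
    by (rule convex_hull_finiteE[OF x(2) fin(1)]) blast
  have "h x < (\<Sum>s\<in>S. u s * h s)"
    using cp fin nx x u unfolding convex_position_def by blast
  also have "\<dots> \<le> (\<Sum>s\<in>{x}. 1 * h s)"
    using x u by (intro lower_tris_le(1)[OF S]) auto
  finally show False by simp
qed

text \<open>The equation for \<open>x\<close> can be solved for \<open>r\<close> since
  \<open>v r\<close> is nonzero; the coefficients are \<open>w\<close>. Hence the affine hull of the
  new triple contains \<open>S\<close>.\<close>

lemma tri_exchange:
  assumes S: "tri S" and x: "x \<notin> S" and v: "sum v S = 1" "(\<Sum>s\<in>S. v s *\<^sub>R s) = x"
    and r: "r \<in> S" "v r \<noteq> 0"
  shows "tri (insert x (S - {r}))"
proof -
  let ?S = "insert x (S - {r})"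
  have fin: "finite S" and c: "card S = 3" using S tri_finite by (auto simp: tri_def)
  have c': "card ?S = 3" using fin c x r by simp
  define w where "w s = (if s = x then 1 else - v s) / v r" for s
  have e: "(\<Sum>s\<in>S - {r}. w s) = - (\<Sum>s\<in>S - {r}. v s) / v r"
    "(\<Sum>s\<in>S - {r}. w s *\<^sub>R s) = (- 1 / v r) *\<^sub>R (\<Sum>s\<in>S - {r}. v s *\<^sub>R s)"
    using x unfolding sum_negf[symmetric] sum_divide_distrib scaleR_sum_right
    by (auto intro!: sum.cong simp: w_def split: if_split_asm)
  have s: "(\<Sum>s\<in>S - {r}. v s) = 1 - v r" "(\<Sum>s\<in>S - {r}. v s *\<^sub>R s) = x - v r *\<^sub>R r"
    using v r fin by (simp_all add: sum.remove algebra_simps)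
  have "sum w ?S = 1"
    using fin x r(2) e(1) s(1) by (simp add: w_def divide_simps)
  moreover have "(\<Sum>s\<in>?S. w s *\<^sub>R s) = r"
    using fin x r(2) e(2) s(2) by (simp add: w_def algebra_simps)
  ultimately have "r \<in> affine hull ?S"
    using affine_hull_finite[of ?S] fin by auto
  then have "S \<subseteq> affine hull ?S"
    using hull_subset[of ?S affine] by blast
  then have "aff_dim S \<le> aff_dim ?S"
    using aff_dim_subset[of S "affine hull ?S"] by simp
  moreover have "aff_dim S = 2" using aff_dim_affine_independent[of S] S by (simp add: tri_def)
  moreover have "aff_dim ?S \<le> 2"
    using aff_dim_le_card[of ?S] fin c' by simp
  ultimately show ?thesis
    using fin c' by (simp add: tri_def affine_independent_iff_card)
qed

text \<open>Caratheodory's theorem gives at most three points. Fewer than three are excluded by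
  \<open>ns\<close>; so is a dependent triple, since on a line two points would do.\<close>

lemma covered_by_tri:
  assumes X: "finite X" and p: "p \<in> convex hull X"
    and ns: "\<And>x y. x \<in> X \<Longrightarrow> y \<in> X \<Longrightarrow> p \<notin> convex hull {x, y}"
  shows "\<exists>S\<subseteq>X. tri S \<and> p \<in> convex hull S"
proof -
  have no2: "\<not> card S \<le> 2" if "S \<subseteq> X" "p \<in> convex hull S" for S
  proof
    assume c: "card S \<le> 2"
    have "finite S" using X that finite_subset by blast
    moreover have "S \<noteq> {}" using that(2) by auto
    ultimately obtain x where x: "x \<in> S" by blast
    have "card (S - {x}) \<le> 1" using c x \<open>finite S\<close> by simp
    then have "S - {x} \<subseteq> {} \<or> (\<exists>y. S - {x} = {y})"
      using \<open>finite S\<close> by (metis card_0_eq card_1_singletonE finite_Diff le_0_eq le_SucE One_nat_def subset_refl)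
    then obtain y where "y \<in> S" "S \<subseteq> {x, y}" using x by blast
    then show False using ns[of x y] x that hull_mono[of S "{x, y}" convex] by blast
  qed
  have "aff_dim X \<le> 2" using aff_dim_le_DIM[of X] by simp
  then obtain S where S: "finite S" "S \<subseteq> X" "card S \<le> 3" "p \<in> convex hull S"
    using p caratheodory_aff_dim[of X] by force
  have c3: "card S = 3" using no2[of S] S by simp
  have "\<not> affine_dependent S"
  proof
    assume "affine_dependent S"
    then have "aff_dim S \<noteq> 2" using S(1) c3 affine_independent_iff_card[of S] by auto
    moreover have "aff_dim S \<le> 2" using aff_dim_le_DIM[of S] by simp
    ultimately have "aff_dim S \<le> 1" by simp
    then obtain R where "R \<subseteq> S" "card R \<le> 2" "p \<in> convex hull R"
      using S(4) caratheodory_aff_dim[of S] by force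
    then show False using no2[of R] S(2) by auto
  qed
  then show ?thesis using S c3 unfolding tri_def by blast
qed

text \<open>Among the triangles containing \<open>p\<close>, one is chosen whose interpolating plane
  is lowest at \<open>p\<close>. A point \<open>x\<close> lifted below that plane could be exchanged
  for a vertex, as in the simplex method, giving a plane lower at \<open>p\<close>; a point on it is
  excluded by \<open>no_coplanar\<close>.\<close>

lemma lower_tris_cover_point:
  assumes X: "finite X" and nc: "no_coplanar h X" and p: "p \<in> convex hull X"
    and ns: "\<And>x y. x \<in> X \<Longrightarrow> y \<in> X \<Longrightarrow> p \<notin> convex hull {x, y}"
  shows "\<exists>S\<in>lower_tris h X. p \<in> convex hull S"
proof -
  let ?C = "{S. S \<subseteq> X \<and> tri S \<and> p \<in> convex hull S}"
  have "\<forall>S. \<exists>f. tri S \<longrightarrow> affine_map f \<and> (\<forall>s\<in>S. f s = h s)"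
    by (metis affine_interpolation)
  then obtain I where I: "\<And>S. tri S \<Longrightarrow> affine_map (I S)" "\<And>S s. tri S \<Longrightarrow> s \<in> S \<Longrightarrow> I S s = h s"
    by metis
  have "finite ?C" by (rule finite_subset[of _ "Pow X"]) (use X in auto)
  moreover have "?C \<noteq> {}" using covered_by_tri[OF X p ns] by blast
  ultimately obtain S where S: "S \<in> ?C" and min: "\<And>S'. S' \<in> ?C \<Longrightarrow> I S p \<le> I S' p"
    using ex_is_arg_min_if_finite[of ?C "\<lambda>S. I S p"] by (auto simp: is_arg_min_linorder)
  have t: "tri S" "S \<subseteq> X" and pS: "p \<in> convex hull S" using S by auto
  have fin: "finite S" and c3: "card S = 3" using t tri_finite by (auto simp: tri_def)
  obtain u where u: "\<And>s. s \<in> S \<Longrightarrow> 0 \<le> u s" "sum u S = 1" "(\<Sum>s\<in>S. u s *\<^sub>R s) = p"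
    by (rule convex_hull_finiteE[OF pS fin]) blast
  \<comment> \<open>Since \<open>p\<close> is on no segment between points of \<open>X\<close>,
    every coordinate is positive; this makes the later step length \<open>\<theta>\<close>
    positive.\<close>
  have upos: "0 < u s" if s: "s \<in> S" for s
  proof (rule ccontr)
    assume "\<not> 0 < u s"
    then have 0: "u s = 0" using u(1)[OF s] by simp
    obtain x y where xy: "S - {s} = {x, y}"
      using c3 s by (metis card_2_iff card_Diff_singleton diff_Suc_1 numeral_3_eq_3 numeral_2_eq_2)
    have "sum u (S - {s}) = 1" "(\<Sum>s\<in>S - {s}. u s *\<^sub>R s) = p"
      using u 0 s fin by (simp_all add: sum.remove)
    then have "p \<in> convex hull (S - {s})"
      using convex_hull_finite[of "S - {s}"] fin u(1) by auto
    then show False using ns[of x y] t(2) xy by auto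
  qed
  have "I S x < h x" if x: "x \<in> X" "x \<notin> S" for x
  proof (rule ccontr)
    assume le: "\<not> I S x < h x"
    obtain v where v: "sum v S = 1" "(\<Sum>s\<in>S. v s *\<^sub>R s) = x" by (rule tri_bary[OF t(1)])
    have Ix: "I S x = (\<Sum>s\<in>S. v s * h s)"
      using affine_map_sum[OF I(1)[OF t(1)] v(1)] v(2) I(2)[OF t(1)] by simp
    have "h x \<noteq> I S x" using nc t x v unfolding Ix no_coplanar_def by blast
    then have lt: "h x < I S x" using le by simp
    let ?P = "{s\<in>S. 0 < v s}"
    have "?P \<noteq> {}"
    proof
      assume "?P = {}"
      then have "sum v S \<le> 0" by (intro sum_nonpos) force
      then show False using v by simp
    qed
    \<comment> \<open>Ratio test: \<open>r\<close> is a vertex whose coordinate reaches 0 first when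
      weight is moved from \<open>S\<close> to \<open>x\<close>. The amount moved is
      \<open>\<theta>\<close>.\<close>
    then obtain r where r: "r \<in> ?P" and rmin: "\<And>s. s \<in> ?P \<Longrightarrow> u r / v r \<le> u s / v s"
      using ex_is_arg_min_if_finite[of ?P "\<lambda>s. u s / v s"] fin by (auto simp: is_arg_min_linorder)
    define \<theta> where "\<theta> = u r / v r"
    have \<theta>: "\<theta> > 0" using upos r by (simp add: \<theta>_def)
    define w where "w s = u s - \<theta> * v s" for s
    have wr: "w r = 0" using r by (simp add: w_def \<theta>_def)
    have w0: "0 \<le> w s" if "s \<in> S" for s
    proof (cases "0 < v s")
      case True
      then show ?thesis using rmin[of s] that by (simp add: w_def \<theta>_def field_simps)
    next
      case False
      then have "\<theta> * v s \<le> 0" using \<theta> by (simp add: mult_le_0_iff)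
      then show ?thesis using u(1)[OF that] by (simp add: w_def)
    qed
    let ?S = "insert x (S - {r})"
    have t': "tri ?S" using tri_exchange[OF t(1) x(2) v, of r] r by simp
    define w' where "w' s = (if s = x then \<theta> else w s)" for s
    have sw: "sum w S = 1 - \<theta>" "(\<Sum>s\<in>S. w s *\<^sub>R s) = p - \<theta> *\<^sub>R x"
      "(\<Sum>s\<in>S. w s * h s) = I S p - \<theta> * I S x"
    proof -
      show "sum w S = 1 - \<theta>" using u v by (simp add: w_def sum_subtractf flip: sum_distrib_left)
      have "(\<Sum>s\<in>S. w s *\<^sub>R s) = p - \<theta> *\<^sub>R (\<Sum>s\<in>S. v s *\<^sub>R s)"
        unfolding u(3)[symmetric] scaleR_sum_right by (simp add: w_def sum_subtractf scaleR_diff_left)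
      then show "(\<Sum>s\<in>S. w s *\<^sub>R s) = p - \<theta> *\<^sub>R x" using v by simp
      have "I S p = (\<Sum>s\<in>S. u s * h s)"
        using affine_map_sum[OF I(1)[OF t(1)] u(2)] u(3) I(2)[OF t(1)] by simp
      then show "(\<Sum>s\<in>S. w s * h s) = I S p - \<theta> * I S x"
        unfolding Ix by (simp add: w_def sum_subtractf left_diff_distrib sum_distrib_left mult.assoc)
    qed
    have ext: "(\<Sum>s\<in>?S. f s) = f x + (\<Sum>s\<in>S. f' s)"
      if "\<And>s. s \<in> S \<Longrightarrow> f s = f' s" "f' r = 0" for f f' :: "real^2 \<Rightarrow> 'z::real_vector"
    proof -
      have "(\<Sum>s\<in>S. f' s) = (\<Sum>s\<in>S - {r}. f' s)"
        using that(2) r fin by (simp add: sum.remove[of S r])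
      also have "\<dots> = (\<Sum>s\<in>S - {r}. f s)"
        using that(1) by (intro sum.cong) auto
      finally show ?thesis using fin x by simp
    qed
    have w'S: "w' s = w s" if "s \<in> S" for s using that x by (auto simp: w'_def)
    have s1: "sum w' ?S = 1"
      using ext[of w' w] w'S wr sw(1) by (simp add: w'_def)
    have s2: "(\<Sum>s\<in>?S. w' s *\<^sub>R s) = p"
      using ext[of "\<lambda>s. w' s *\<^sub>R s" "\<lambda>s. w s *\<^sub>R s"] w'S wr sw(2) by (simp add: w'_def)
    have s3: "(\<Sum>s\<in>?S. w' s * h s) = \<theta> * h x + (I S p - \<theta> * I S x)"
      using ext[of "\<lambda>s. w' s * h s" "\<lambda>s. w s * h s"] w'S wr sw(3) by (simp add: w'_def)
    have "p \<in> convex hull ?S"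
      unfolding convex_hull_finite[OF tri_finite[OF t']] using s1 s2 w0 w'S \<theta>
      by (auto intro!: exI[of _ w'] simp: w'_def)
    then have "I S p \<le> I ?S p" using t' t x by (intro min) auto
    also have "I ?S p = (\<Sum>s\<in>?S. w' s * h s)"
    proof -
      have "I ?S p = (\<Sum>s\<in>?S. w' s * I ?S s)"
        using affine_map_sum[OF I(1)[OF t'] s1] s2 by simp
      also have "\<dots> = (\<Sum>s\<in>?S. w' s * h s)"
        by (rule sum.cong[OF refl]) (simp only: I(2)[OF t'])
      finally show ?thesis .
    qed
    also have "\<dots> < I S p" unfolding s3 using \<theta> lt by simp
    finally show False by simp
  qed
  then have "S \<in> lower_tris h X"
    unfolding lower_tris_def using t I[OF t(1)] by blast
  then show ?thesis using pS by blast
qed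

text \<open>What \<open>U\<close> misses of the interior is open and negligible, hence empty, and
  the closure of the interior contains \<open>K\<close>. Coverings can thus be checked away from
  segments and boundaries.\<close>

lemma convex_subset_closed_mod_negligible:
  fixes K :: "'a::euclidean_space set"
  assumes K: "convex K" "interior K \<noteq> {}" and U: "closed U" and N: "negligible N"
    and sub: "interior K \<subseteq> U \<union> N"
  shows "K \<subseteq> U"
proof -
  have "interior K - U \<subseteq> N" using sub by blast
  then have "negligible (interior K - U)" using N negligible_subset by blast
  moreover have "open (interior K - U)" using U by (intro open_Diff) auto
  ultimately have "interior K - U = {}" using open_not_negligible by blast
  then have "closure (interior K) \<subseteq> U" using U by (intro closure_minimal) auto
  then show ?thesis using convex_closure_interior[OF K] closure_subset by blast
qed

section \<open>Lower triangles form a mesh\<close>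

lemma noncollinear_interior:
  fixes X :: "(real^2) set"
  assumes "\<not> collinear X"
  shows "interior (convex hull X) \<noteq> {}"
proof -
  have "aff_dim X = 2"
    using assms aff_dim_le_DIM[of X] by (simp add: collinear_aff_dim)
  then have "affine hull X = UNIV" using aff_dim_eq_full[of X] by simp
  then have "rel_interior (convex hull X) = interior (convex hull X)"
    by (intro rel_interior_interior) (simp add: affine_hull_convex_hull)
  moreover have "X \<noteq> {}" using assms by auto
  ultimately show ?thesis using rel_interior_eq_empty[of "convex hull X"] by simp
qed

lemma closed_UN_tri: "finite F \<Longrightarrow> (\<And>S. S \<in> F \<Longrightarrow> tri S) \<Longrightarrow> closed (\<Union>S\<in>F. convex hull S)"
  by (auto intro!: closed_UN compact_imp_closed finite_imp_compact_convex_hull tri_finite)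

lemma lower_tris_finite: "finite X \<Longrightarrow> finite (lower_tris h X)"
  by (rule finite_subset[of _ "Pow X"]) (auto simp: lower_tris_def)

lemma lower_tris_cover:
  assumes X: "finite X" and nc: "no_coplanar h X" and n: "\<not> collinear X"
  shows "convex hull X \<subseteq> (\<Union>S\<in>lower_tris h X. convex hull S)"
proof (rule convex_subset_closed_mod_negligible)
  let ?N = "\<Union>(x, y)\<in>X \<times> X. convex hull {x, y}"
  have "negligible (convex hull {x, y})" for x y :: "real^2"
  proof -
    have "card {x, y} \<le> DIM(real^2)" by (simp add: card_insert_if)
    then have "interior (convex hull {x, y}) = {}" by (intro empty_interior_convex_hull) auto
    then have "convex hull {x, y} \<subseteq> frontier (convex hull {x, y})"
      by (simp add: frontier_def closure_subset)
    then show ?thesis using negligible_convex_frontier[of "convex hull {x, y}"] negligible_subset by blast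
  qed
  then show "negligible ?N"
    using X by (intro negligible_Union finite_imageI) auto
  show "interior (convex hull X) \<subseteq> (\<Union>S\<in>lower_tris h X. convex hull S) \<union> ?N"
  proof
    fix p assume "p \<in> interior (convex hull X)"
    then have p: "p \<in> convex hull X" using interior_subset by blast
    show "p \<in> (\<Union>S\<in>lower_tris h X. convex hull S) \<union> ?N"
    proof (cases "p \<in> ?N")
      case False
      then show ?thesis using lower_tris_cover_point[OF X nc p] by blast
    qed simp
  qed
  show "closed (\<Union>S\<in>lower_tris h X. convex hull S)"
    using X by (intro closed_UN_tri lower_tris_finite) (auto simp: lower_tris_def)
qed (use n noncollinear_interior in auto)

lemma lower_tris_mesh:
  assumes X: "finite X" and n: "\<not> collinear X" and nc: "no_coplanar h X" and cp: "convex_position h X"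
  shows "mesh (lower_tris h X) X"
  unfolding mesh_def
proof (intro conjI)
  have sub: "\<And>S. S \<in> lower_tris h X \<Longrightarrow> S \<subseteq> X" by (auto simp: lower_tris_def)
  show cov: "(\<Union>S\<in>lower_tris h X. convex hull S) = convex hull X"
    using lower_tris_cover[OF X nc n] sub hull_mono by (auto simp: subset_antisym) blast
  show "\<Union> (lower_tris h X) = X"
  proof
    show "X \<subseteq> \<Union> (lower_tris h X)"
    proof
      fix x assume x: "x \<in> X"
      then have "x \<in> (\<Union>S\<in>lower_tris h X. convex hull S)" unfolding cov by (rule hull_inc)
      then show "x \<in> \<Union> (lower_tris h X)" using lower_tris_vertex[OF cp _ x] by blast
    qed
  qed (use sub in blast)
  show "finite (lower_tris h X)" by (rule lower_tris_finite[OF X])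
  show "\<forall>S\<in>lower_tris h X. tri S" by (auto simp: lower_tris_def)
qed (use lower_tris_Int in blast)

section \<open>Exponential heights\<close>

text \<open>After division by \<open>exp (\<tau> * l m)\<close> every term except the one at
  \<open>m\<close> tends to 0.\<close>

lemma eventually_exp_sum_pos:
  fixes l :: "'a \<Rightarrow> real"
  assumes X: "finite X" and m: "m \<in> X" "c m > 0"
    and lt: "\<And>x. x \<in> X \<Longrightarrow> x \<noteq> m \<Longrightarrow> c x \<noteq> 0 \<Longrightarrow> l x < l m"
  shows "eventually (\<lambda>\<tau>. 0 < (\<Sum>x\<in>X. c x * exp (\<tau> * l x))) at_top"
proof -
  have lim: "((\<lambda>\<tau>. c x * exp (\<tau> * (l x - l m))) \<longlongrightarrow> (if x = m then c m else 0)) at_top"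
    if x: "x \<in> X" for x
  proof (cases "x = m \<or> c x = 0")
    case False
    then have "l x - l m < 0" using lt[OF x] by simp
    then have "filterlim (\<lambda>\<tau>. (l x - l m) * \<tau>) at_bot at_top"
      by (intro filterlim_tendsto_neg_mult_at_bot[OF tendsto_const _ filterlim_ident])
    then have "((\<lambda>\<tau>. exp ((l x - l m) * \<tau>)) \<longlongrightarrow> 0) at_top"
      by (rule filterlim_compose[OF exp_at_bot])
    then have "((\<lambda>\<tau>. c x * exp ((l x - l m) * \<tau>)) \<longlongrightarrow> c x * 0) at_top"
      by (intro tendsto_intros)
    then show ?thesis using False by (simp add: mult.commute)
  qed auto
  have "((\<lambda>\<tau>. \<Sum>x\<in>X. c x * exp (\<tau> * (l x - l m))) \<longlongrightarrow> (\<Sum>x\<in>X. if x = m then c m else 0)) at_top"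
    by (intro tendsto_sum lim)
  also have "(\<Sum>x\<in>X. if x = m then c m else 0) = c m" using X m by simp
  finally have "eventually (\<lambda>\<tau>. 0 < (\<Sum>x\<in>X. c x * exp (\<tau> * (l x - l m)))) at_top"
    by (rule order_tendstoD(1)) (rule m)
  then show ?thesis
  proof (rule eventually_mono)
    fix \<tau> assume *: "0 < (\<Sum>x\<in>X. c x * exp (\<tau> * (l x - l m)))"
    have "(\<Sum>x\<in>X. c x * exp (\<tau> * l x)) = exp (\<tau> * l m) * (\<Sum>x\<in>X. c x * exp (\<tau> * (l x - l m)))"
      unfolding sum_distrib_left
      by (intro sum.cong refl) (simp add: right_diff_distrib mult.left_commute flip: exp_add)
    then show "0 < (\<Sum>x\<in>X. c x * exp (\<tau> * l x))" using * by simp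
  qed
qed

text \<open>Among the points with nonzero coefficient the one with the largest \<open>l\<close> is
  unique by injectivity; its term dominates and decides the sign.\<close>

lemma eventually_exp_sum_nonzero:
  fixes l :: "'a \<Rightarrow> real"
  assumes X: "finite X" and inj: "inj_on l X" and m: "x0 \<in> X" "c x0 \<noteq> 0"
  shows "eventually (\<lambda>\<tau>. (\<Sum>x\<in>X. c x * exp (\<tau> * l x)) \<noteq> 0) at_top"
proof -
  let ?Y = "{x\<in>X. c x \<noteq> 0}"
  have "finite ?Y" "?Y \<noteq> {}" using X m by auto
  then obtain m where m: "m \<in> ?Y" "\<And>x. x \<in> ?Y \<Longrightarrow> l x \<le> l m"
    using ex_is_arg_min_if_finite[of ?Y "\<lambda>x. - l x"] by (auto simp: is_arg_min_linorder)
  have lt: "l x < l m" if "x \<in> X" "x \<noteq> m" "c x \<noteq> 0" for x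
    using m that inj by (metis (mono_tags, lifting) inj_onD mem_Collect_eq order_le_less)
  consider "c m > 0" | "- c m > 0" using m(1) by force
  then show ?thesis
  proof cases
    case 1
    have "eventually (\<lambda>\<tau>. 0 < (\<Sum>x\<in>X. c x * exp (\<tau> * l x))) at_top"
      using m(1) 1 lt by (intro eventually_exp_sum_pos[OF X]) auto
    then show ?thesis by (rule eventually_mono) simp
  next
    case 2
    have "eventually (\<lambda>\<tau>. 0 < (\<Sum>x\<in>X. - c x * exp (\<tau> * l x))) at_top"
      using m(1) 2 lt by (intro eventually_exp_sum_pos[OF X, of m "\<lambda>x. - c x"]) auto
    then show ?thesis by (rule eventually_mono) (simp add: sum_negf)
  qed
qed

text \<open>Coplanarity of the lifts of \<open>S\<close> and \<open>x\<close> is the vanishing of an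
  exponential sum. Its coefficients, the barycentric coordinates of \<open>x\<close> and -1 at
  \<open>x\<close> itself, do not depend on \<open>\<tau>\<close>, and only finitely many pairs
  \<open>(S, x)\<close> occur.\<close>

lemma eventually_no_coplanar:
  fixes n :: "real^2"
  assumes X: "finite X" and inj: "inj_on ((\<bullet>) n) X"
  shows "eventually (\<lambda>\<tau>. no_coplanar (\<lambda>x. exp (\<tau> * (n \<bullet> x))) X) at_top"
proof -
  let ?P = "\<lambda>S x \<tau>. tri S \<and> x \<notin> S \<longrightarrow> (\<forall>u. sum u S = 1 \<and> (\<Sum>s\<in>S. u s *\<^sub>R s) = x \<longrightarrow>
    exp (\<tau> * (n \<bullet> x)) \<noteq> (\<Sum>s\<in>S. u s * exp (\<tau> * (n \<bullet> s))))"
  have "eventually (?P S x) at_top" if S: "S \<subseteq> X" and x: "x \<in> X" for S x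
  proof (cases "tri S \<and> x \<notin> S")
    case True
    then have fin: "finite S" and ind: "\<not> affine_dependent S" using tri_finite by (auto simp: tri_def)
    have tS: "tri S" using True by simp
    obtain v where v: "sum v S = 1" "(\<Sum>s\<in>S. v s *\<^sub>R s) = x" by (rule tri_bary[OF tS])
    define c where "c s = (if s = x then - 1 else v s)" for s
    have "eventually (\<lambda>\<tau>. (\<Sum>s\<in>insert x S. c s * exp (\<tau> * (n \<bullet> s))) \<noteq> 0) at_top"
    proof (rule eventually_exp_sum_nonzero)
      show "inj_on ((\<bullet>) n) (insert x S)" using inj S x by (meson inj_on_subset insert_subset)
    qed (use fin in \<open>auto simp: c_def\<close>)
    then show ?thesis
    proof (rule eventually_mono)
      fix \<tau> assume *: "(\<Sum>s\<in>insert x S. c s * exp (\<tau> * (n \<bullet> s))) \<noteq> 0"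
      have cv: "c s = v s" if "s \<in> S" for s using True that by (auto simp: c_def)
      have "(\<Sum>s\<in>insert x S. c s * exp (\<tau> * (n \<bullet> s)))
          = (\<Sum>s\<in>S. v s * exp (\<tau> * (n \<bullet> s))) - exp (\<tau> * (n \<bullet> x))"
        using fin True cv by (simp add: c_def[of x])
      moreover have "u s = v s" if "sum u S = 1" "(\<Sum>s\<in>S. u s *\<^sub>R s) = x" "s \<in> S" for u s
        using bary_unique[OF ind _ _ that(3), of u v] that v by simp
      ultimately show "?P S x \<tau>" using * by auto
    qed
  qed auto
  then have "eventually (\<lambda>\<tau>. \<forall>(S, x)\<in>Pow X \<times> X. ?P S x \<tau>) at_top"
    using X by (intro eventually_ball_finite) auto
  then show ?thesis
  proof (rule eventually_mono)
    fix \<tau> assume "\<forall>(S, x)\<in>Pow X \<times> X. ?P S x \<tau>"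
    then have *: "?P S x \<tau>" if "S \<subseteq> X" "x \<in> X" for S x using that by blast
    show "no_coplanar (\<lambda>x. exp (\<tau> * (n \<bullet> x))) X"
      unfolding no_coplanar_def using * by blast
  qed
qed

text \<open>The exponential lies strictly above its tangent line away from the point of contact, and
  this is averaged with the weights \<open>u\<close>. Injectivity keeps \<open>S\<close> away from
  the point of contact.\<close>

lemma convex_position_exp:
  fixes n :: "real^2"
  assumes inj: "inj_on ((\<bullet>) n) X" and \<tau>: "\<tau> > 0"
  shows "convex_position (\<lambda>x. exp (\<tau> * (n \<bullet> x))) X"
  unfolding convex_position_def
proof (intro allI impI, elim conjE)
  fix S u x
  assume S: "S \<subseteq> X" "finite S" and x: "x \<in> X - S" and u: "\<forall>s\<in>S. 0 \<le> u s" "sum u S = 1"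
    and ux: "(\<Sum>s\<in>S. u s *\<^sub>R s) = x"
  let ?h = "\<lambda>x. exp (\<tau> * (n \<bullet> x))"
  have tangent: "?h x * (1 + \<tau> * (n \<bullet> s - n \<bullet> x)) < ?h s" if "s \<in> S" for s
  proof -
    have "n \<bullet> s \<noteq> n \<bullet> x" using that x S inj by (auto simp: inj_on_def)
    then have "1 + \<tau> * (n \<bullet> s - n \<bullet> x) < exp (\<tau> * (n \<bullet> s - n \<bullet> x))"
      using exp_minus_greater[of "\<tau> * (n \<bullet> x - n \<bullet> s)"] \<tau> by (simp add: algebra_simps)
    then have "?h x * (1 + \<tau> * (n \<bullet> s - n \<bullet> x)) < ?h x * exp (\<tau> * (n \<bullet> s - n \<bullet> x))"
      by (intro mult_strict_left_mono) auto
    also have "\<dots> = ?h s" by (simp add: algebra_simps flip: exp_add)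
    finally show ?thesis .
  qed
  have "\<exists>s\<in>S. u s \<noteq> 0"
    using u(2) by (metis sum.neutral zero_neq_one)
  then obtain r where r: "r \<in> S" "u r > 0" using u(1) by (metis order_le_less)
  have "n \<bullet> x = (\<Sum>s\<in>S. u s * (n \<bullet> s))" by (simp add: inner_sum_right flip: ux)
  then have "?h x = (\<Sum>s\<in>S. u s * (?h x * (1 + \<tau> * (n \<bullet> s - n \<bullet> x))))"
  proof -
    have "(\<Sum>s\<in>S. u s * (?h x * (1 + \<tau> * (n \<bullet> s - n \<bullet> x))))
        = (\<Sum>s\<in>S. ?h x * ((1 - \<tau> * (n \<bullet> x)) * u s + \<tau> * (u s * (n \<bullet> s))))"
      by (intro sum.cong refl) (simp add: algebra_simps)
    also have "\<dots> = ?h x * ((1 - \<tau> * (n \<bullet> x)) * sum u S + \<tau> * (\<Sum>s\<in>S. u s * (n \<bullet> s)))"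
      by (simp only: sum.distrib flip: sum_distrib_left)
    also have "\<dots> = ?h x"
      using u(2) \<open>n \<bullet> x = _\<close> by simp
    finally show ?thesis by simp
  qed
  also have "\<dots> < (\<Sum>s\<in>S. u s * ?h s)"
  proof (rule sum_strict_mono_ex1[OF S(2)])
    show "\<forall>s\<in>S. u s * (?h x * (1 + \<tau> * (n \<bullet> s - n \<bullet> x))) \<le> u s * ?h s"
      using u(1) tangent by (intro ballI mult_left_mono) (auto intro: less_imp_le)
    show "\<exists>s\<in>S. u s * (?h x * (1 + \<tau> * (n \<bullet> s - n \<bullet> x))) < u s * ?h s"
      using r tangent by (intro bexI[of _ r] mult_strict_left_mono) auto
  qed
  finally show "?h x < (\<Sum>s\<in>S. u s * ?h s)" .
qed

section \<open>Existence of meshes\<close>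

lemma mesh_exists:
  assumes X: "finite X" "\<not> collinear X"
  obtains F where "mesh F X"
proof -
  obtain n :: "real^2" where n: "inj_on ((\<bullet>) n) X"
    using injective_functional[OF X(1), of UNIV] by auto
  have "eventually (\<lambda>\<tau>. no_coplanar (\<lambda>x. exp (\<tau> * (n \<bullet> x))) X \<and> \<tau> > 0) at_top"
    by (intro eventually_conj eventually_no_coplanar X n eventually_gt_at_top)
  then obtain \<tau> where "no_coplanar (\<lambda>x. exp (\<tau> * (n \<bullet> x))) X" "\<tau> > 0"
    using eventually_happens by force
  then show ?thesis
    using lower_tris_mesh[OF X _ convex_position_exp[OF n]] that by blast
qed

text \<open>Lifting \<open>b\<close> far above the other points makes it the last point of a placing triangulation,
  so the triangles at \<open>b\<close> only fill the region outside the convex hull of \<open>A\<close>.\<close>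

lemma mesh_placing:
  assumes A: "finite A" "\<not> collinear A" and b: "b \<notin> convex hull A"
  obtains F where "mesh F (insert b A)" "mesh {S \<in> F. b \<notin> S} A"
proof -
  let ?B = "insert b A"
  have fB: "finite ?B" and nB: "\<not> collinear ?B"
    using A collinear_subset[of ?B A] by auto
  have fH: "closed (convex hull A)" using A by (intro compact_imp_closed finite_imp_compact_convex_hull)
  obtain a0 \<beta> where a0: "a0 \<bullet> b < \<beta>" "\<And>x. x \<in> convex hull A \<Longrightarrow> \<beta> < a0 \<bullet> x"
    using separating_hyperplane_closed_point[OF convex_convex_hull fH b] by blast
  \<comment> \<open>The directions in which \<open>b\<close> lies beyond all of \<open>A\<close>.
    They form an open set containing \<open>- a0\<close>, so one of them can also be chosen
    injective.\<close>
  define U where "U = (\<Inter>a\<in>A. {n. 0 < (b - a) \<bullet> n})"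
  have "open U" unfolding U_def using A(1) by (intro open_INT) (auto intro: open_halfspace_gt)
  moreover have "- a0 \<in> U"
  proof -
    have "a0 \<bullet> b < a0 \<bullet> a" if "a \<in> A" for a using a0(1) a0(2)[OF hull_inc[OF that]] by simp
    then have "0 < (b - a) \<bullet> (- a0)" if "a \<in> A" for a
      using that by (simp add: inner_diff_right inner_commute[of _ a0])
    then show ?thesis by (simp add: U_def)
  qed
  ultimately obtain n where n: "n \<in> U" "inj_on ((\<bullet>) n) ?B"
    using injective_functional[OF fB, of U] by blast
  have sep: "n \<bullet> a < n \<bullet> b" if "a \<in> A" for a
    using n(1) that by (auto simp: U_def inner_diff_right inner_commute)
  let ?h = "\<lambda>\<tau> x. exp (\<tau> * (n \<bullet> x))"
  \<comment> \<open>No lower triangle at \<open>b\<close> may overlap the hull of \<open>A\<close>.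
    For each of the finitely many candidates this holds for large \<open>\<tau>\<close>.\<close>
  let ?Q = "\<lambda>S \<tau>. tri S \<and> b \<in> S \<and> interior (convex hull S) \<inter> convex hull A \<noteq> {} \<longrightarrow>
    S \<notin> lower_tris (?h \<tau>) ?B"
  have "eventually (?Q S) at_top" if S: "S \<subseteq> ?B" for S
  proof (cases "tri S \<and> b \<in> S \<and> interior (convex hull S) \<inter> convex hull A \<noteq> {}")
    case True
    then have tS: "tri S" and fS: "finite S" using tri_finite by auto
    obtain q where q: "q \<in> interior (convex hull S)" "q \<in> convex hull A" using True by blast
    obtain u where u: "\<forall>s\<in>S. 0 < u s" "sum u S = 1" "(\<Sum>s\<in>S. u s *\<^sub>R s) = q"
      using q(1) unfolding tri_interior[OF tS] by blast
    obtain v where v: "\<And>s. s \<in> A \<Longrightarrow> 0 \<le> v s" "sum v A = 1" "(\<Sum>s\<in>A. v s *\<^sub>R s) = q"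
      by (rule convex_hull_finiteE[OF q(2) A(1)]) blast
    have bA: "b \<notin> A" using b hull_inc by metis
    \<comment> \<open>The coefficients compare two representations of \<open>q\<close>, over
      \<open>S\<close> and over \<open>A\<close>. At \<open>b\<close>, where the exponent is
      largest, the coefficient is \<open>u b > 0\<close>; so for large \<open>\<tau>\<close> the
      lift over \<open>A\<close> is lower, and \<open>S\<close> is no lower triangle.\<close>
    define c where "c s = (if s \<in> S then u s else 0) - (if s \<in> A then v s else 0)" for s
    have split: "(\<Sum>s\<in>?B. c s * g s) = (\<Sum>s\<in>S. u s * g s) - (\<Sum>s\<in>A. v s * g s)" for g :: "real^2 \<Rightarrow> real"
    proof -
      have "(\<Sum>s\<in>?B. c s * g s) = (\<Sum>s\<in>?B. (if s \<in> S then u s * g s else 0) - (if s \<in> A then v s * g s else 0))"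
        by (intro sum.cong refl) (simp add: c_def left_diff_distrib)
      also have "\<dots> = (\<Sum>s\<in>?B \<inter> S. u s * g s) - (\<Sum>s\<in>?B \<inter> A. v s * g s)"
        unfolding sum_subtractf sum.inter_restrict[OF fB] ..
      also have "?B \<inter> S = S" using S by blast
      also have "?B \<inter> A = A" by blast
      finally show ?thesis .
    qed
    have "eventually (\<lambda>\<tau>. 0 < (\<Sum>s\<in>?B. c s * ?h \<tau> s)) at_top"
      using sep u(1) True bA by (intro eventually_exp_sum_pos[OF fB, of b]) (auto simp: c_def)
    then show ?thesis
    proof (rule eventually_mono)
      fix \<tau> assume "0 < (\<Sum>s\<in>?B. c s * ?h \<tau> s)"
      then have lt: "(\<Sum>s\<in>A. v s * ?h \<tau> s) < (\<Sum>s\<in>S. u s * ?h \<tau> s)" unfolding split by simp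
      have "\<not> S \<in> lower_tris (?h \<tau>) ?B"
      proof
        assume "S \<in> lower_tris (?h \<tau>) ?B"
        from lower_tris_le(1)[OF this A(1) _ _ u(2) v(1,2)] show False
          using lt u v by (force intro: less_imp_le)
      qed
      then show "?Q S \<tau>" by blast
    qed
  qed auto
  then have "eventually (\<lambda>\<tau>. \<forall>S\<in>Pow ?B. ?Q S \<tau>) at_top"
    using fB by (intro eventually_ball_finite) auto
  then have "eventually (\<lambda>\<tau>. (\<forall>S\<in>Pow ?B. ?Q S \<tau>) \<and> no_coplanar (?h \<tau>) ?B \<and> \<tau> > 0) at_top"
    by (intro eventually_conj eventually_no_coplanar fB n eventually_gt_at_top)
  then obtain \<tau> where \<tau>: "\<forall>S\<in>Pow ?B. ?Q S \<tau>" "no_coplanar (?h \<tau>) ?B" "\<tau> > 0"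
    using eventually_happens by force
  define F where "F = lower_tris (?h \<tau>) ?B"
  note cp = convex_position_exp[OF n(2) \<tau>(3)]
  have m: "mesh F ?B" unfolding F_def by (rule lower_tris_mesh[OF fB nB \<tau>(2) cp])
  have sub: "S \<subseteq> ?B" if "S \<in> F" for S using that by (auto simp: F_def lower_tris_def)
  let ?FA = "{S \<in> F. b \<notin> S}"
  have "convex hull A \<subseteq> (\<Union>S\<in>?FA. convex hull S)"
  proof (rule convex_subset_closed_mod_negligible)
    \<comment> \<open>A point of the hull of \<open>A\<close> covered by a triangle at
      \<open>b\<close> lies on the boundary of that triangle, hence in \<open>?N\<close>.\<close>
    let ?N = "\<Union>S\<in>F. frontier (convex hull S)"
    show "negligible ?N"
      using meshD(1)[OF m] by (intro negligible_Union finite_imageI) (auto intro: negligible_convex_frontier)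
    show "closed (\<Union>S\<in>?FA. convex hull S)"
      using meshD(1,2)[OF m] by (intro closed_UN_tri) auto
    show "interior (convex hull A) \<subseteq> (\<Union>S\<in>?FA. convex hull S) \<union> ?N"
    proof
      fix p assume "p \<in> interior (convex hull A)"
      then have p: "p \<in> convex hull A" using interior_subset by blast
      then have "p \<in> convex hull ?B" using hull_mono[of A ?B convex] by blast
      then obtain S where S: "S \<in> F" "p \<in> convex hull S" using meshD(4)[OF m] by blast
      show "p \<in> (\<Union>S\<in>?FA. convex hull S) \<union> ?N"
      proof (cases "b \<in> S")
        case True
        have "interior (convex hull S) \<inter> convex hull A = {}"
          using \<tau>(1) S(1) True meshD(2)[OF m S(1)] sub[OF S(1)] unfolding F_def by blast
        then have "p \<in> frontier (convex hull S)"
          using S(2) p by (auto simp: frontier_def intro: subsetD[OF closure_subset])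
        then show ?thesis using S(1) by blast
      qed (use S in blast)
    qed
  qed (use A(2) noncollinear_interior in auto)
  moreover have subA: "S \<subseteq> A" if "S \<in> ?FA" for S using that sub by blast
  ultimately have cov: "(\<Union>S\<in>?FA. convex hull S) = convex hull A"
    using hull_mono[of _ A convex] by blast
  have "mesh ?FA A" unfolding mesh_def
  proof (intro conjI)
    show "finite ?FA" using meshD(1)[OF m] by simp
    show "\<forall>S\<in>?FA. tri S" using meshD(2)[OF m] by blast
    show "\<forall>S\<in>?FA. \<forall>S'\<in>?FA. convex hull S \<inter> convex hull S' = convex hull (S \<inter> S')"
      using meshD(3)[OF m] by blast
    show "(\<Union>S\<in>?FA. convex hull S) = convex hull A" by (rule cov)
    show "\<Union>?FA = A"
    proof
      show "A \<subseteq> \<Union>?FA"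
      proof
        fix a assume a: "a \<in> A"
        then have "a \<in> (\<Union>S\<in>?FA. convex hull S)" unfolding cov by (rule hull_inc)
        then show "a \<in> \<Union>?FA" using mesh_vertex[OF m] a by blast
      qed
    qed (use subA in blast)
  qed
  with m show ?thesis using that by blast
qed

section \<open>Doubled triangles\<close>

text \<open>Halving the sides of the doubled triangle \<open>2S\<close> gives the translates \<open>x + S\<close> for \<open>x \<in> S\<close>
  and the middle triangle, which is \<open>-S\<close> translated by the sum of the vertices.\<close>

definition piece :: "(real^2) set \<Rightarrow> (real^2) option \<Rightarrow> (real^2) set" where
  "piece S i = (case i of None \<Rightarrow> (+) (\<Sum>S) ` uminus ` S | Some x \<Rightarrow> (+) x ` S)"

lemma tri_translate: "tri ((+) x ` S) \<longleftrightarrow> tri S"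
  using affine_dependent_translation_eq[of S x] by (simp add: tri_def card_image)

lemma tri_uminus: "tri S \<Longrightarrow> tri (uminus ` S)"
  using aff_dim_injective_linear_image[of "uminus :: real^2 \<Rightarrow> real^2" S]
  by (simp add: tri_def affine_independent_iff_card card_image linear_uminus)

lemma tri_piece: "tri S \<Longrightarrow> tri (piece S i)"
  by (simp add: piece_def tri_translate tri_uminus split: option.split)

lemma interior_hull_translate:
  fixes S :: "(real^2) set"
  shows "interior (convex hull ((+) x ` S)) = (+) x ` interior (convex hull S)"
  by (simp add: convex_hull_translation interior_translation)

lemma interior_hull_uminus:
  fixes S :: "(real^2) set"
  shows "interior (convex hull (uminus ` S)) = uminus ` interior (convex hull S)"
  by (simp add: interior_negations linear_uminus flip: convex_hull_linear_image)

text \<open>In coordinates of total 2 on the doubled triangle, the cutting lines are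
  \<open>w s = 1\<close>: the corner at \<open>x\<close> lies where \<open>w x > 1\<close>, the
  middle piece where all coordinates are below 1.\<close>

lemma piece_coords:
  assumes S: "tri S" and i: "i \<in> insert None (Some ` S)"
    and p: "p \<in> interior (convex hull (piece S i))"
  obtains w where "\<And>s. s \<in> S \<Longrightarrow> 0 < w s" "sum w S = 2" "(\<Sum>s\<in>S. w s *\<^sub>R s) = p"
    "\<And>x. i = Some x \<Longrightarrow> 1 < w x" "\<And>s. i = None \<Longrightarrow> s \<in> S \<Longrightarrow> w s < 1"
proof (cases i)
  case None
  then obtain q where q: "p = \<Sum>S - q" "q \<in> interior (convex hull S)"
    using p by (auto simp: piece_def interior_hull_translate interior_hull_uminus)
  then obtain u where u: "\<forall>s\<in>S. 0 < u s" "sum u S = 1" "(\<Sum>s\<in>S. u s *\<^sub>R s) = q"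
    unfolding tri_interior[OF S] by blast
  have fin: "finite S" and c: "card S = 3" using S tri_finite by (auto simp: tri_def)
  have "u s < 1" if s: "s \<in> S" for s
  proof -
    have "card (S - {s}) = 2" using c s by simp
    then have "S - {s} \<noteq> {}" by (metis card.empty zero_neq_numeral)
    then have "0 < sum u (S - {s})" using u(1) fin by (intro sum_pos) auto
    then show ?thesis using u(2) sum.remove[OF fin s, of u] by simp
  qed
  then show ?thesis
    using None u q c by (intro that[of "\<lambda>s. 1 - u s"])
      (auto simp: sum_subtractf scaleR_diff_left)
next
  case (Some x)
  then have x: "x \<in> S" using i by auto
  obtain q where q: "p = x + q" "q \<in> interior (convex hull S)"
    using p Some by (auto simp: piece_def interior_hull_translate)
  then obtain u where u: "\<forall>s\<in>S. 0 < u s" "sum u S = 1" "(\<Sum>s\<in>S. u s *\<^sub>R s) = q"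
    unfolding tri_interior[OF S] by blast
  have fin: "finite S" using S tri_finite by auto
  have pos: "0 < (if s = x then 1 else 0) + u s" if "s \<in> S" for s using u(1) that by auto
  show ?thesis
    using Some x u q fin pos
    by (intro that[of "\<lambda>s. (if s = x then 1 else 0) + u s"])
      (auto simp: sum.distrib scaleR_add_left sum_delta_scaleR)
qed

text \<open>Pieces lie inside the doubled triangle. This keeps apart the pieces of different
  triangles of a packing.\<close>

lemma piece_interior_half:
  assumes S: "tri S" and i: "i \<in> insert None (Some ` S)"
    and p: "p \<in> interior (convex hull (piece S i))"
  shows "(1/2) *\<^sub>R p \<in> interior (convex hull S)"
proof -
  obtain w where w: "\<And>s. s \<in> S \<Longrightarrow> 0 < w s" "sum w S = 2" "(\<Sum>s\<in>S. w s *\<^sub>R s) = p"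
    by (rule piece_coords[OF S i p]) blast
  have "(\<Sum>s\<in>S. (w s / 2) *\<^sub>R s) = (1/2) *\<^sub>R p"
    unfolding w(3)[symmetric] scaleR_sum_right by (intro sum.cong) auto
  then show ?thesis unfolding tri_interior[OF S] mem_Collect_eq
    using w by (intro exI[of _ "\<lambda>s. w s / 2"]) (simp flip: sum_divide_distrib)
qed

text \<open>Coordinates of total 2 are unique. None can be both above and below 1, and two of them
  above 1 would exceed the total.\<close>

lemma piece_disjoint:
  assumes S: "tri S" and i: "i \<in> insert None (Some ` S)" and j: "j \<in> insert None (Some ` S)"
    and p: "p \<in> interior (convex hull (piece S i))" "p \<in> interior (convex hull (piece S j))"
  shows "i = j"
proof (rule ccontr)
  assume ij: "i \<noteq> j"
  have fin: "finite S" and ind: "\<not> affine_dependent S" using S tri_finite by (auto simp: tri_def)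
  obtain w where w: "\<And>s. s \<in> S \<Longrightarrow> 0 < w s" "sum w S = 2" "(\<Sum>s\<in>S. w s *\<^sub>R s) = p"
    "\<And>x. i = Some x \<Longrightarrow> 1 < w x" "\<And>s. i = None \<Longrightarrow> s \<in> S \<Longrightarrow> w s < 1"
    by (rule piece_coords[OF S i p(1)]) blast
  obtain w' where w': "sum w' S = 2" "(\<Sum>s\<in>S. w' s *\<^sub>R s) = p"
    "\<And>x. j = Some x \<Longrightarrow> 1 < w' x" "\<And>s. j = None \<Longrightarrow> s \<in> S \<Longrightarrow> w' s < 1"
    by (rule piece_coords[OF S j p(2)]) blast
  have eq: "w s = w' s" if "s \<in> S" for s
    using bary_unique[OF ind _ _ that, of w w'] w(2,3) w'(1,2) by simp
  show False
  proof (cases "i = None \<or> j = None")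
    case True
    then show False using ij i j w(4,5) w'(3,4) eq by force
  next
    case False
    then obtain x y where xy: "i = Some x" "j = Some y" "x \<in> S" "y \<in> S" "x \<noteq> y"
      using i j ij by auto
    have "sum w {x, y} \<le> sum w S" using xy fin w(1) by (intro sum_mono2) (auto intro: less_imp_le)
    moreover have "1 < w x" "1 < w y" using w(4) w'(3) eq xy by auto
    ultimately show False using xy(5) w(2) by simp
  qed
qed

text \<open>The corner at \<open>b\<close> is left out because its vertex \<open>b + b\<close> need
  not lie in the sumset. So a triangle yields three pieces if \<open>b\<close> is one of its
  vertices and four otherwise.\<close>

lemma pieces_packing:
  fixes b :: "real^2"
  assumes F: "packing F"
  defines "J \<equiv> Sigma F (\<lambda>S. insert None (Some ` (S - {b})))"
  shows "packing ((\<lambda>(S, i). piece S i) ` J)"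
    and "card ((\<lambda>(S, i). piece S i) ` J) = (\<Sum>S\<in>F. 1 + card (S - {b}))"
proof -
  have t: "tri S" if "S \<in> F" for S using F that by (auto simp: packing_def)
  have fF: "finite F" using F by (simp add: packing_def)
  have fin: "finite S" if "S \<in> F" for S using t[OF that] tri_finite by blast
  have disj: "S = S' \<and> i = i'"
    if "(S, i) \<in> J" "(S', i') \<in> J" "p \<in> interior (convex hull (piece S i))"
      "p \<in> interior (convex hull (piece S' i'))" for S i S' i' p
  proof -
    have S: "S \<in> F" "S' \<in> F" and i: "i \<in> insert None (Some ` S)" "i' \<in> insert None (Some ` S')"
      using that by (auto simp: J_def)
    have "(1/2) *\<^sub>R p \<in> interior (convex hull S)" "(1/2) *\<^sub>R p \<in> interior (convex hull S')"
      using piece_interior_half t S i that by blast+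
    then have "S = S'" using F S unfolding packing_def by blast
    then show ?thesis using piece_disjoint[OF t[OF S(1)] i(1) _ that(3)] i that(4) by simp
  qed
  have fJ: "finite J" unfolding J_def using fF fin by auto
  show "packing ((\<lambda>(S, i). piece S i) ` J)" unfolding packing_def
  proof (intro conjI ballI impI)
    show "finite ((\<lambda>(S, i). piece S i) ` J)" using fJ by simp
    show "tri P" if "P \<in> (\<lambda>(S, i). piece S i) ` J" for P
      using that t tri_piece by (auto simp: J_def)
    fix P P' assume P: "P \<in> (\<lambda>(S, i). piece S i) ` J" "P' \<in> (\<lambda>(S, i). piece S i) ` J" "P \<noteq> P'"
    then show "interior (convex hull P) \<inter> interior (convex hull P') = {}" using disj by force
  qed
  have "inj_on (\<lambda>(S, i). piece S i) J"
  proof (rule inj_onI, clarify)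
    fix S i S' i' assume J: "(S, i) \<in> J" "(S', i') \<in> J" and eq: "piece S i = piece S' i'"
    have "tri (piece S i)" using J(1) t tri_piece by (auto simp: J_def)
    then obtain p where "p \<in> interior (convex hull (piece S i))" using tri_interior_nonempty by blast
    then show "S = S' \<and> i = i'" using disj[OF J] eq by simp
  qed
  then have "card ((\<lambda>(S, i). piece S i) ` J) = card J" by (rule card_image)
  also have "\<dots> = (\<Sum>S\<in>F. card (insert None (Some ` (S - {b}))))"
    unfolding J_def using fF fin by (intro card_SigmaI) auto
  also have "\<dots> = (\<Sum>S\<in>F. 1 + card (S - {b}))"
  proof (rule sum.cong[OF refl])
    fix S assume "S \<in> F"
    then have "finite (Some ` (S - {b}))" using fin by simp
    then show "card (insert None (Some ` (S - {b}))) = 1 + card (S - {b})"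
      by (subst card_insert_disjoint) (auto simp: card_image)
  qed
  finally show "card ((\<lambda>(S, i). piece S i) ` J) = (\<Sum>S\<in>F. 1 + card (S - {b}))" .
qed

text \<open>The vertices of the middle piece are sums of two different vertices of \<open>S\<close>,
  one of which is not \<open>b\<close>; those of the corner at \<open>x\<close> are sums with
  \<open>x \<noteq> b\<close>. This puts the pieces into the sumset.\<close>

lemma piece_vertices:
  assumes S: "tri S" and i: "i \<in> insert None (Some ` (S - {b}))" and v: "v \<in> piece S i"
  shows "\<exists>y\<in>S. \<exists>z\<in>S. y \<noteq> b \<and> v = y + z"
proof (cases i)
  case None
  then obtain x where x: "x \<in> S" "v = \<Sum>S - x" using v by (auto simp: piece_def)
  have fin: "finite S" and "card S = 3" using S tri_finite by (auto simp: tri_def)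
  then have "card (S - {x}) = 2" using x by simp
  then obtain y z where yz: "S - {x} = {y, z}" "y \<noteq> z" by (meson card_2_iff)
  have "v = y + z" using x yz fin sum.remove[OF fin x(1), of "\<lambda>s. s"] by simp
  moreover have "y \<in> S" "z \<in> S" using yz by auto
  ultimately show ?thesis using yz(2) by (metis add.commute)
next
  case (Some x)
  then show ?thesis using i v by (auto simp: piece_def)
qed

text \<open>This is \<open>(p + q)^2 \<le> 2 * p^2 + 2 * q^2\<close>, and it leaves an inequality
  linear in the numbers of triangles to be shown.\<close>

lemma sqrt_add_le:
  fixes s t n :: nat
  assumes "2 * s + 2 * t \<le> n"
  shows "sqrt (real s) + sqrt (real t) \<le> sqrt (real n)"
proof (rule real_le_rsqrt)
  have "(sqrt (real s) + sqrt (real t))\<^sup>2 \<le> 2 * (sqrt (real s))\<^sup>2 + 2 * (sqrt (real t))\<^sup>2"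
    using zero_le_power2[of "sqrt (real s) - sqrt (real t)"] by (simp add: power2_sum power2_diff)
  also have "\<dots> \<le> real n" using assms by simp
  finally show "(sqrt (real s) + sqrt (real t))\<^sup>2 \<le> real n" .
qed

section \<open>Flags as a formula for \<open>tr\<close>, and new points of the sumset\<close>

lemma tr_flags:
  assumes X: "finite X" "\<not> collinear X" and d: "generic d X"
  shows "tr X = card (flags d X (convex hull X))"
  by (rule mesh_exists[OF X]) (simp add: tr_mesh[OF _ X(1)] mesh_card[OF _ d])

text \<open>The sum of two vertices of a mesh cannot be a shifted point \<open>x + b\<close>: both sides are twice
  a point of the triangle containing \<open>b\<close>, whose barycentric coordinates would show \<open>b = x\<close>.\<close>

lemma shifted_not_vertex_sum:
  assumes m: "mesh F A" and S: "S \<in> F" and b: "b \<notin> A"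
    and u: "\<And>s. s \<in> S \<Longrightarrow> 0 \<le> u s" "sum u S = 1" "(\<Sum>s\<in>S. u s *\<^sub>R s) = b"
    and x: "x \<in> S" "0 < u x"
    and S': "S' \<in> F" "y \<in> S'" "z \<in> S'"
  shows "x + b \<noteq> y + z"
proof
  assume eq: "x + b = y + z"
  have t: "tri S" "tri S'" using meshD(2)[OF m] S S' by auto
  have fin: "finite S" "finite S'" and ind: "\<not> affine_dependent S" "\<not> affine_dependent S'"
    using t tri_finite by (auto simp: tri_def)
  define q where "q = (1/2) *\<^sub>R (x + b)"
  have "b \<in> convex hull S" using u fin by (auto simp: convex_hull_finite)
  then have "q \<in> convex hull S"
    unfolding q_def scaleR_add_right using x hull_inc[of x S convex] by (intro convexD) auto
  moreover have "q \<in> convex hull S'"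
    unfolding q_def eq scaleR_add_right using S' hull_inc[of _ S' convex] by (intro convexD) auto
  ultimately have "q \<in> convex hull (S \<inter> S')" using meshD(3)[OF m S S'(1)] by blast
  moreover have "finite (S \<inter> S')" using fin by simp
  ultimately obtain c where c: "sum c (S \<inter> S') = 1" "(\<Sum>s\<in>S \<inter> S'. c s *\<^sub>R s) = q"
    by (metis convex_hull_finiteE)
  define e where "e r s = (if s = r then 1 else (0::real))" for r s :: "real^2"
  have e: "sum (e r) R = 1" "(\<Sum>s\<in>R. e r s *\<^sub>R s) = r" if "finite R" "r \<in> R" for r R
    using that by (simp_all add: e_def sum_delta_scaleR)
  have q2: "2 *\<^sub>R q = y + z" "2 *\<^sub>R q = x + b" by (simp_all add: q_def eq)
  \<comment> \<open>On \<open>S'\<close> the point \<open>2 *\<^sub>R q\<close> has the coordinates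
    \<open>e y + e z\<close>, positive at \<open>r\<close>, and also the doubled \<open>c\<close>,
    extended by 0 outside \<open>S\<close>. Uniqueness forces \<open>r\<close> into
    \<open>S\<close>.\<close>
  have yz: "r \<in> S" if r: "r \<in> {y, z}" for r
  proof (rule ccontr)
    assume "r \<notin> S"
    let ?c = "\<lambda>s. 2 * (if s \<in> S then c s else 0)"
    have "sum ?c S' = 2" "(\<Sum>s\<in>S'. ?c s *\<^sub>R s) = y + z"
    proof -
      have "(\<Sum>s\<in>S'. if s \<in> S then c s else 0) = 1"
        using c(1) fin by (simp add: Int_commute flip: sum.inter_restrict)
      then show "sum ?c S' = 2" by (simp flip: sum_distrib_left)
      have "(\<Sum>s\<in>S'. ?c s *\<^sub>R s) = 2 *\<^sub>R (\<Sum>s\<in>S'. if s \<in> S then c s *\<^sub>R s else 0)"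
        unfolding scaleR_sum_right by (intro sum.cong) auto
      also have "(\<Sum>s\<in>S'. if s \<in> S then c s *\<^sub>R s else 0) = q"
        using c(2) fin by (simp add: Int_commute flip: sum.inter_restrict)
      finally show "(\<Sum>s\<in>S'. ?c s *\<^sub>R s) = y + z" using q2 by simp
    qed
    moreover have "(\<Sum>s\<in>S'. e y s + e z s) = 2" "(\<Sum>s\<in>S'. (e y s + e z s) *\<^sub>R s) = y + z"
      using e fin S' by (simp_all add: sum.distrib scaleR_add_left)
    ultimately have "?c r = e y r + e z r"
      using bary_unique[OF ind(2), of ?c "\<lambda>s. e y s + e z s" r] r S' by auto
    then show False using \<open>r \<notin> S\<close> r by (auto simp: e_def split: if_splits)
  qed
  have "e x s + u s = e y s + e z s" if "s \<in> S" for s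
  proof (rule bary_unique[OF ind(1) _ _ that])
    show "(\<Sum>s\<in>S. e x s + u s) = (\<Sum>s\<in>S. e y s + e z s)"
      using e fin x yz u by (simp add: sum.distrib)
    show "(\<Sum>s\<in>S. (e x s + u s) *\<^sub>R s) = (\<Sum>s\<in>S. (e y s + e z s) *\<^sub>R s)"
      using e fin x yz u eq by (simp add: sum.distrib scaleR_add_left)
  qed
  \<comment> \<open>At \<open>x\<close> the left side exceeds 1, so both indicators on the right
    must be 1.\<close>
  from this[OF x(1)] have "y = x" "z = x"
    using x(2) by (auto simp: e_def split: if_splits)
  then have "b = x" using eq by simp
  moreover have "x \<in> A" using x(1) S meshD(5)[OF m] by blast
  ultimately show False using b by blast
qed

section \<open>The sumset\<close>

lemma noncollinear_sumset:
  fixes A B :: "(real^2) set"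
  assumes "\<not> collinear A" "B \<noteq> {}"
  shows "\<not> collinear (A + B)"
proof
  obtain b where "b \<in> B" using assms by blast
  assume "collinear (A + B)"
  moreover have "(+) b ` A \<subseteq> A + B"
    using \<open>b \<in> B\<close> by (auto simp: set_plus_def add.commute)
  ultimately have "collinear ((+) b ` A)" using collinear_subset by blast
  then show False using assms(1) collinear_aff_dim aff_dim_translation_eq by metis
qed

lemma translate_hull_subset:
  fixes A B :: "'a::real_vector set"
  assumes "a \<in> A" "x \<in> convex hull B"
  shows "a + x \<in> convex hull (A + B)"
proof -
  have "(+) a ` (convex hull B) = convex hull ((+) a ` B)" by (simp add: convex_hull_translation)
  also have "\<dots> \<subseteq> convex hull (A + B)"
    using assms(1) by (intro hull_mono) (auto simp: set_plus_def)
  finally show ?thesis using assms(2) by blast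
qed

text \<open>The flags of the \<open>4 * tr A\<close> pieces are supplemented by flags at
  \<open>x + b\<close> and \<open>y + b\<close>, for two vertices \<open>x\<close>, \<open>y\<close>
  of the triangle containing \<open>b\<close>. Each of these points carries a translate of every
  flag at \<open>b\<close>, and the number of flags at \<open>b\<close> is the increase of
  \<open>tr\<close> from \<open>A\<close> to \<open>insert b A\<close>.\<close>

lemma tr_sumset_inside:
  fixes A :: "(real^2) set"
  assumes A: "finite A" "\<not> collinear A" and b: "b \<notin> A" "b \<in> convex hull A"
  shows "2 * tr A + 2 * tr (insert b A) \<le> tr (A + insert b A)"
proof -
  let ?B = "insert b A" and ?Y = "A + insert b A"
  let ?K = "convex hull ?Y"
  have A0: "A \<noteq> {}" using A(2) by auto
  have Y: "finite ?Y" "\<not> collinear ?Y" using A noncollinear_sumset[of A ?B] by (auto intro: finite_set_plus)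
  have B: "finite ?B" "\<not> collinear ?B" using A collinear_subset[of ?B A] by auto
  obtain d where d: "generic d (?B \<union> ?Y)" using generic_exists[of "?B \<union> ?Y"] B(1) Y(1) by auto
  have dA: "generic d A" "generic d ?B" "generic d ?Y" using generic_mono[OF d] by auto
  obtain F where m: "mesh F A" by (rule mesh_exists[OF A])
  define J where "J = Sigma F (\<lambda>S. insert None (Some ` (S - {b})))"
  define P where "P = (\<lambda>(S, i). piece S i) ` J"
  have SA: "S \<subseteq> A" if "S \<in> F" for S using that meshD(5)[OF m] by blast
  have "card P = (\<Sum>S\<in>F. 1 + card (S - {b}))"
    unfolding P_def J_def by (rule pieces_packing(2)[OF mesh_packing[OF m]])
  also have "\<dots> = (\<Sum>S\<in>F. 4)"
  proof (rule sum.cong[OF refl])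
    fix S assume S: "S \<in> F"
    then have "S - {b} = S" using SA b(1) by blast
    then show "1 + card (S - {b}) = 4" using meshD(2)[OF m S] by (simp add: tri_def)
  qed
  finally have cP: "card P = 4 * tr A" by (simp add: tr_mesh[OF m A(1)])
  have pP: "packing P" unfolding P_def J_def by (rule pieces_packing(1)[OF mesh_packing[OF m]])
  have vert: "\<exists>S\<in>F. \<exists>y\<in>S. \<exists>z\<in>S. v = y + z" if v: "v \<in> \<Union>P" for v
  proof -
    obtain S i where S: "S \<in> F" "i \<in> insert None (Some ` (S - {b}))" "v \<in> piece S i"
      using v unfolding P_def J_def by auto
    then show ?thesis using piece_vertices[OF meshD(2)[OF m S(1)] S(2,3)] by blast
  qed
  have VY: "\<Union>P \<subseteq> ?Y" using vert SA by (fastforce simp: set_plus_def)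
  \<comment> \<open>Only flags at vertices of pieces are counted here, so that those at the new
    points can be added disjointly.\<close>
  have le: "4 * tr A \<le> card (flags d (\<Union>P) ?K)"
    unfolding cP[symmetric]
  proof (rule packing_card_le[OF pP])
    show "generic d (\<Union>P)" using generic_mono[OF dA(3) VY] .
    show "finite (\<Union>P)" using VY Y(1) finite_subset by blast
    show "convex hull S \<subseteq> ?K" if "S \<in> P" for S using that VY by (intro hull_mono) auto
  qed auto
  obtain S where S: "S \<in> F" "b \<in> convex hull S" using b(2) meshD(4)[OF m] by blast
  have tS: "tri S" and fS: "finite S" using meshD(2)[OF m S(1)] tri_finite by auto
  obtain u where u: "\<And>s. s \<in> S \<Longrightarrow> 0 \<le> u s" "sum u S = 1" "(\<Sum>s\<in>S. u s *\<^sub>R s) = b"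
    by (rule convex_hull_finiteE[OF S(2) fS]) blast
  have "\<exists>x\<in>S. \<exists>y\<in>S. x \<noteq> y \<and> 0 < u x \<and> 0 < u y"
  proof (rule ccontr)
    assume no: "\<not> ?thesis"
    have "\<exists>s\<in>S. u s \<noteq> 0" using u(2) by (metis sum.neutral zero_neq_one)
    then obtain x where x: "x \<in> S" "0 < u x" using u(1) by (metis order_le_less)
    then have z: "u s = 0" if "s \<in> S - {x}" for s using no u(1)[of s] that by (metis Diff_iff insertCI order_le_less)
    have "sum u S = u x" "(\<Sum>s\<in>S. u s *\<^sub>R s) = u x *\<^sub>R x"
      unfolding sum.remove[OF fS x(1)] using z by simp_all
    then have "b = x" using u by simp
    then show False using b(1) x(1) SA[OF S(1)] by blast
  qed
  then obtain x y where xy: "x \<in> S" "y \<in> S" "x \<noteq> y" "0 < u x" "0 < u y" by blast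
  have new: "r + b \<notin> \<Union>P" if "r \<in> {x, y}" for r
    using vert shifted_not_vertex_sum[OF m S(1) b(1) u] xy that by blast
  let ?W = "flags d {b} (convex hull A)"
  define E where "E = (\<lambda>(r, (v, e)). (r + v, e)) ` ({x, y} \<times> ?W)"
  have "inj_on (\<lambda>(r, (v, e)). (r + v, e)) ({x, y} \<times> ?W)"
    by (auto simp: inj_on_def flags_def)
  then have cE: "card E = 2 * card ?W"
    unfolding E_def by (simp add: card_image card_cartesian_product xy(3))
  have ES: "E \<subseteq> flags d ?Y ?K"
  proof
    fix p assume "p \<in> E"
    then obtain r e where p: "p = (r + b, e)" "r \<in> {x, y}" "e \<in> {d, - d}" "inward (convex hull A) b e"
      by (auto simp: E_def flags_def)
    have rA: "r \<in> A" using p xy SA[OF S(1)] by auto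
    obtain \<epsilon> where \<epsilon>: "\<epsilon> > 0" "b + \<epsilon> *\<^sub>R e \<in> convex hull A" using p by (auto simp: inward_def)
    have "b + \<epsilon> *\<^sub>R e \<in> convex hull ?B" using \<epsilon>(2) hull_mono[of A ?B convex] by blast
    then have "r + (b + \<epsilon> *\<^sub>R e) \<in> ?K" by (rule translate_hull_subset[OF rA])
    then have "inward ?K (r + b) e" using \<epsilon>(1) by (auto simp: inward_def add.assoc)
    moreover have "r + b \<in> ?Y" using rA by (auto simp: set_plus_def)
    ultimately show "p \<in> flags d ?Y ?K" using p by (auto simp: flags_def)
  qed
  have "E \<inter> flags d (\<Union>P) ?K = {}" using new by (auto simp: E_def flags_def)
  moreover have "flags d (\<Union>P) ?K \<subseteq> flags d ?Y ?K" by (rule flags_mono[OF VY subset_refl])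
  ultimately have "card E + card (flags d (\<Union>P) ?K) \<le> card (flags d ?Y ?K)"
    using ES finite_flags[OF Y(1), of d ?K]
    by (metis card_Un_disjoint card_mono finite_subset le_sup_iff)
  then have 1: "4 * tr A + 2 * card ?W \<le> tr ?Y"
    using le cE tr_flags[OF Y dA(3)] by simp
  \<comment> \<open>Adding a point of the hull leaves the hull unchanged, so the flags at
    \<open>A\<close> stay and only those at \<open>b\<close> are new.\<close>
  have hB: "convex hull ?B = convex hull A" using b(2) by (rule hull_redundant)
  have "flags d ?B (convex hull A) = flags d A (convex hull A) \<union> ?W" by (auto simp: flags_def)
  moreover have "flags d A (convex hull A) \<inter> ?W = {}" using b(1) by (auto simp: flags_def)
  ultimately have "tr ?B = tr A + card ?W"
    using tr_flags[OF A dA(1)] tr_flags[OF B dA(2)] A(1)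
    by (simp add: hB card_Un_disjoint finite_flags)
  then show ?thesis using 1 by simp
qed

text \<open>In the placing mesh the triangles avoiding \<open>b\<close> triangulate \<open>A\<close>
  and keep all four pieces; the others keep three. With \<open>B = insert b A\<close> this gives
  \<open>3 * tr B + tr A\<close> pieces, and \<open>tr A \<le> tr B\<close> trades one
  \<open>tr B\<close> for \<open>tr A\<close>.\<close>

lemma tr_sumset_outside:
  fixes A :: "(real^2) set"
  assumes A: "finite A" "\<not> collinear A" and b: "b \<notin> convex hull A"
  shows "2 * tr A + 2 * tr (insert b A) \<le> tr (A + insert b A)"
proof -
  let ?B = "insert b A" and ?Y = "A + insert b A"
  have Y: "finite ?Y" "\<not> collinear ?Y" using A noncollinear_sumset[of A ?B] by (auto intro: finite_set_plus)
  obtain d where d: "generic d ?Y" using generic_exists[OF Y(1)] by blast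
  obtain F where m: "mesh F ?B" and mA: "mesh {S \<in> F. b \<notin> S} A" by (rule mesh_placing[OF A b])
  define J where "J = Sigma F (\<lambda>S. insert None (Some ` (S - {b})))"
  define P where "P = (\<lambda>(S, i). piece S i) ` J"
  have fF: "finite F" by (rule meshD(1)[OF m])
  have tF: "tr ?B = card F" using tr_mesh[OF m] A(1) by simp
  have tA: "tr A = card {S \<in> F. b \<notin> S}" by (rule tr_mesh[OF mA A(1)])
  have "card P = (\<Sum>S\<in>F. 1 + card (S - {b}))"
    unfolding P_def J_def by (rule pieces_packing(2)[OF mesh_packing[OF m]])
  also have "\<dots> = (\<Sum>S\<in>F. 3 + (if b \<notin> S then 1 else 0))"
  proof (rule sum.cong[OF refl])
    fix S assume S: "S \<in> F"
    have "card S = 3" using meshD(2)[OF m S] by (simp add: tri_def)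
    then show "1 + card (S - {b}) = 3 + (if b \<notin> S then 1 else 0)"
      by (cases "b \<in> S") simp_all
  qed
  also have "\<dots> = 3 * tr ?B + tr A"
    using fF by (simp add: sum.distrib tF tA flip: sum.inter_filter)
  finally have cP: "card P = 3 * tr ?B + tr A" .
  have pP: "packing P" unfolding P_def J_def by (rule pieces_packing(1)[OF mesh_packing[OF m]])
  have VY: "\<Union>P \<subseteq> ?Y"
  proof
    fix v assume "v \<in> \<Union>P"
    then obtain S i where S: "S \<in> F" "i \<in> insert None (Some ` (S - {b}))" "v \<in> piece S i"
      unfolding P_def J_def by auto
    then obtain y z where "y \<in> S" "z \<in> S" "y \<noteq> b" "v = y + z"
      using piece_vertices[OF meshD(2)[OF m S(1)] S(2,3)] by blast
    moreover have "S \<subseteq> ?B" using meshD(5)[OF m] S(1) by blast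
    ultimately have "y \<in> A" "z \<in> ?B" "v = y + z" by auto
    then show "v \<in> ?Y" by (auto simp: set_plus_def)
  qed
  have "card P \<le> card (flags d ?Y (convex hull ?Y))"
  proof (rule packing_card_le[OF pP d Y(1) VY])
    show "convex hull S \<subseteq> convex hull ?Y" if "S \<in> P" for S using that VY by (intro hull_mono) auto
  qed
  then have "3 * tr ?B + tr A \<le> tr ?Y" using cP tr_flags[OF Y d] by simp
  moreover have "tr A \<le> tr ?B" unfolding tF tA using fF by (intro card_mono) auto
  ultimately show ?thesis by simp
qed

theorem theorem1p4:
  fixes A B :: "(real^2) set" and b :: "real^2"
  assumes "finite A" and "\<not> collinear A"
    and "b \<notin> A" and "B = A \<union> {b}"
  shows "sqrt (real (tr (A + B))) \<ge> sqrt (real (tr A)) + sqrt (real (tr B))"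
proof -
  have "2 * tr A + 2 * tr (insert b A) \<le> tr (A + insert b A)"
    using tr_sumset_inside tr_sumset_outside assms(1-3) by (cases "b \<in> convex hull A") auto
  then show ?thesis using assms(4) sqrt_add_le by simp
qed

end
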